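(* Let $0<q<1$, $l>0$ and $0\le\varphi<2\pi$. Consider the bounded selfadjoint operator on $\mathcal H_l$ $$I_1^{(\varphi)}=\frac a2\,q^{J_0}-b-\frac12\,q^{J_0/4}\bigl(e^{\mathrm i\varphi}J_++e^{-\mathrm i\varphi}J_-\bigr)q^{J_0/4},$$ where $b=(q^{1/2}-q^{-1/2})^{-1}$ and $a=(q^{1/4}+q^{-1/4})b$. The (generalized) eigenfunctions of $I_1^{(\varphi)}$ are $$\frac{(q^{l/2}e^{\mathrm i\varphi}x;q)_\infty\,(q^{(l+1)/2}e^{\mathrm i\varphi}x;q)_\infty}{(q^{(1-2l)/4}e^{\mathrm i(\theta+\varphi)}x;q)_\infty\,(q^{(1-2l)/4}e^{-\mathrm i(\theta-\varphi)}x;q)_\infty},\qquad \nu=\cos\theta,$$ with the corresponding eigenvalues $\lambda=(1-\nu)/(q^{-1/2}-q^{1/2})$. The spectrum of $I_1^{(\varphi)}$ is simple and covers the interval $[0,\,2q^{1/2}/(1-q)]$.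
   Context: Notation: $(a;q)_n=\prod_{r=0}^{n-1}(1-aq^r)$, $(a;q)_\infty=\prod_{r\ge0}(1-aq^r)$, $[c]_q=\frac{q^{c/2}-q^{-c/2}}{q^{1/2}-q^{-1/2}}$. Discrete series representation $T_l^+$ of $U_q(\mathrm{su}_{1,1})$ ($l>0$): $\mathcal H_l$ is the Hilbert space with orthonormal basis the monomials $f^l_n(x;q)=c^l_n(q)x^n$, $n=0,1,2,\dots$, where $c^l_n(q)=q^{(1-2l)n/4}\left(\frac{(q^{2l};q)_n}{(q;q)_n}\right)^{1/2}$. The operators act by $J_0f^l_n=(l+n)f^l_n$, $J_+f^l_n=\sqrt{[2l+n]_q[n+1]_q}\,f^l_{n+1}$, $J_-f^l_n=\sqrt{[2l+n-1]_q[n]_q}\,f^l_{n-1}$, and $q^{cJ_0}f^l_n=q^{c(l+n)}f^l_n$. Thus $I_1^{(\varphi)}$ is tridiagonal in the basis $f^l_n$ and also acts on arbitrary formal power series $\sum_n a_nf^l_n$ (coefficientwise). The generalized eigenfunctions are power series in $x$ that need not belong to $\mathcal H_l$, and the eigenvalue equation is understood for this action. *)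

theory Defs
  imports "HOL-Analysis.Analysis"
begin

definition qnum :: "real \<Rightarrow> real \<Rightarrow> real" where
  "qnum q c = (q powr (c / 2) - q powr (- c / 2)) / (q powr (1 / 2) - q powr (- 1 / 2))"

definition qpoch :: "real \<Rightarrow> real \<Rightarrow> nat \<Rightarrow> real" where
  "qpoch a q n = (\<Prod>r<n. 1 - a * q ^ r)"

definition qpoch_inf :: "complex \<Rightarrow> real \<Rightarrow> complex" where
  "qpoch_inf a q = (\<Prod>r. 1 - a * of_real q ^ r)"


subsection \<open>The representation space\<close>

text \<open>
  The vectors are formal power series in \<open>x\<close>. Every operator below acts on all of them;
  the Hilbert space is the set of those whose coordinates with respect to the monomials
  \<open>dsr_basis q l n\<close> are square summable.
\<close>

definition dsr_const :: "real \<Rightarrow> real \<Rightarrow> nat \<Rightarrow> real" where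
  "dsr_const q l n = q powr ((1 - 2 * l) * real n / 4) * sqrt (qpoch (q powr (2 * l)) q n / qpoch q q n)"

definition dsr_basis :: "real \<Rightarrow> real \<Rightarrow> nat \<Rightarrow> complex fps" where
  "dsr_basis q l n = fps_const (of_real (dsr_const q l n)) * fps_X ^ n"

definition dsr_coord :: "real \<Rightarrow> real \<Rightarrow> complex fps \<Rightarrow> nat \<Rightarrow> complex" where
  "dsr_coord q l g n = fps_nth g n / of_real (dsr_const q l n)"

text \<open>The formal series \<open>\<Sum>n. a n * dsr_basis q l n\<close>.\<close>

definition dsr_series :: "real \<Rightarrow> real \<Rightarrow> (nat \<Rightarrow> complex) \<Rightarrow> complex fps" where
  "dsr_series q l a = Abs_fps (\<lambda>n. a n * of_real (dsr_const q l n))"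

definition dsr_space :: "real \<Rightarrow> real \<Rightarrow> complex fps set" where
  "dsr_space q l = {g. summable (\<lambda>n. (cmod (dsr_coord q l g n))\<^sup>2)}"

definition dsr_inner :: "real \<Rightarrow> real \<Rightarrow> complex fps \<Rightarrow> complex fps \<Rightarrow> complex" where
  "dsr_inner q l g h = (\<Sum>n. dsr_coord q l g n * cnj (dsr_coord q l h n))"

definition dsr_norm :: "real \<Rightarrow> real \<Rightarrow> complex fps \<Rightarrow> real" where
  "dsr_norm q l g = sqrt (Re (dsr_inner q l g g))"


subsection \<open>The operators\<close>

definition qpow_J0 :: "real \<Rightarrow> real \<Rightarrow> real \<Rightarrow> complex fps \<Rightarrow> complex fps" where
  "qpow_J0 q l c g = dsr_series q l (\<lambda>n. of_real (q powr (c * (l + real n))) * dsr_coord q l g n)"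

text \<open>
  The index shifts below come from collecting coefficients; \<open>J_plus_basis\<close> and \<open>J_minus_basis\<close>
  give the action on the basis.
\<close>

definition J_plus :: "real \<Rightarrow> real \<Rightarrow> complex fps \<Rightarrow> complex fps" where
  "J_plus q l g = dsr_series q l (\<lambda>n. case n of 0 \<Rightarrow> 0
     | Suc m \<Rightarrow> of_real (sqrt (qnum q (2 * l + real m) * qnum q (real m + 1))) * dsr_coord q l g m)"

definition J_minus :: "real \<Rightarrow> real \<Rightarrow> complex fps \<Rightarrow> complex fps" where
  "J_minus q l g = dsr_series q l (\<lambda>n.
     of_real (sqrt (qnum q (2 * l + real n) * qnum q (real n + 1))) * dsr_coord q l g (Suc n))"

definition I1 :: "real \<Rightarrow> real \<Rightarrow> real \<Rightarrow> complex fps \<Rightarrow> complex fps" where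
  "I1 q l \<phi> g =
    (let b = 1 / (q powr (1 / 2) - q powr (- 1 / 2));
         a = (q powr (1 / 4) + q powr (- 1 / 4)) * b;
         h = qpow_J0 q l (1 / 4) g
     in fps_const (of_real (a / 2)) * qpow_J0 q l 1 g - fps_const (of_real b) * g
        - fps_const (1 / 2) * qpow_J0 q l (1 / 4)
            (fps_const (exp (\<i> * of_real \<phi>)) * J_plus q l h
             + fps_const (exp (- \<i> * of_real \<phi>)) * J_minus q l h))"


subsection \<open>Operators on the Hilbert space\<close>

definition dsr_bounded_op :: "real \<Rightarrow> real \<Rightarrow> (complex fps \<Rightarrow> complex fps) \<Rightarrow> bool" where
  "dsr_bounded_op q l T \<longleftrightarrow>
     (\<forall>g\<in>dsr_space q l. T g \<in> dsr_space q l) \<and>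
     (\<forall>g\<in>dsr_space q l. \<forall>h\<in>dsr_space q l. T (g + h) = T g + T h) \<and>
     (\<forall>c. \<forall>g\<in>dsr_space q l. T (fps_const c * g) = fps_const c * T g) \<and>
     (\<exists>K. \<forall>g\<in>dsr_space q l. dsr_norm q l (T g) \<le> K * dsr_norm q l g)"

definition dsr_selfadjoint :: "real \<Rightarrow> real \<Rightarrow> (complex fps \<Rightarrow> complex fps) \<Rightarrow> bool" where
  "dsr_selfadjoint q l T \<longleftrightarrow>
     (\<forall>g\<in>dsr_space q l. \<forall>h\<in>dsr_space q l. dsr_inner q l (T g) h = dsr_inner q l g (T h))"

definition dsr_resolvent_set :: "real \<Rightarrow> real \<Rightarrow> (complex fps \<Rightarrow> complex fps) \<Rightarrow> complex set" where
  "dsr_resolvent_set q l T =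
     {z. \<exists>R. dsr_bounded_op q l R \<and>
             (\<forall>g\<in>dsr_space q l. T (R g) - fps_const z * R g = g \<and> R (T g - fps_const z * g) = g)}"

definition dsr_spectrum :: "real \<Rightarrow> real \<Rightarrow> (complex fps \<Rightarrow> complex fps) \<Rightarrow> complex set" where
  "dsr_spectrum q l T = - dsr_resolvent_set q l T"

text \<open>
  A bounded selfadjoint operator has simple spectrum if it has a cyclic vector, that is, a vector
  \<open>v\<close> such that the linear span of \<open>v, T v, T (T v), \<dots>\<close> is dense.
\<close>

definition dsr_simple_spectrum :: "real \<Rightarrow> real \<Rightarrow> (complex fps \<Rightarrow> complex fps) \<Rightarrow> bool" where
  "dsr_simple_spectrum q l T \<longleftrightarrow>
     (\<exists>v\<in>dsr_space q l. \<forall>g\<in>dsr_space q l. \<forall>\<epsilon>>0. \<exists>N c.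
        dsr_norm q l (g - (\<Sum>k<N. fps_const (c k) * (T ^^ k) v)) < \<epsilon>)"

text \<open>A generalized eigenfunction is a nonzero formal series, not necessarily in the Hilbert space.\<close>

definition gen_eigenfunction :: "(complex fps \<Rightarrow> complex fps) \<Rightarrow> complex \<Rightarrow> complex fps \<Rightarrow> bool" where
  "gen_eigenfunction T \<mu> g \<longleftrightarrow> g \<noteq> 0 \<and> T g = fps_const \<mu> * g"


subsection \<open>The explicit eigenfunctions and eigenvalues\<close>

definition I1_eigenfun :: "real \<Rightarrow> real \<Rightarrow> real \<Rightarrow> complex \<Rightarrow> complex \<Rightarrow> complex" where
  "I1_eigenfun q l \<phi> \<theta> x =
     qpoch_inf (of_real (q powr (l / 2)) * exp (\<i> * of_real \<phi>) * x) q *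
     qpoch_inf (of_real (q powr ((l + 1) / 2)) * exp (\<i> * of_real \<phi>) * x) q /
     (qpoch_inf (of_real (q powr ((1 - 2 * l) / 4)) * exp (\<i> * (\<theta> + of_real \<phi>)) * x) q *
      qpoch_inf (of_real (q powr ((1 - 2 * l) / 4)) * exp (- \<i> * (\<theta> - of_real \<phi>)) * x) q)"

definition I1_eigenval :: "real \<Rightarrow> complex \<Rightarrow> complex" where
  "I1_eigenval q \<nu> = (1 - \<nu>) / of_real (q powr (- 1 / 2) - q powr (1 / 2))"


subsection \<open>The defining relations on the basis\<close>

lemma qpoch_pos:
  assumes "0 < q" "q < 1" "0 < a" "a < 1"
  shows "qpoch a q n > 0"
  unfolding qpoch_def
proof (rule prod_pos)
  fix r
  have "q ^ r \<le> 1" using assms by (simp add: power_le_one)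
  hence "a * q ^ r \<le> a * 1" using assms by (intro mult_left_mono) auto
  thus "0 < 1 - a * q ^ r" using assms by linarith
qed

lemma dsr_const_pos:
  assumes "0 < q" "q < 1" "0 < l"
  shows "dsr_const q l n > 0"
proof -
  have "q powr (2 * l) < 1" using assms powr_less_mono'[of q 0 "2 * l"] by simp
  thus ?thesis using assms unfolding dsr_const_def
    by (intro mult_pos_pos) (auto intro!: divide_pos_pos qpoch_pos)
qed

lemma dsr_basis_nth: "fps_nth (dsr_basis q l n) m = (if m = n then of_real (dsr_const q l n) else 0)"
  by (simp add: dsr_basis_def)

lemma dsr_coord_basis:
  assumes "0 < q" "q < 1" "0 < l"
  shows "dsr_coord q l (dsr_basis q l n) m = (if m = n then 1 else 0)"
  using dsr_const_pos[OF assms, of n] by (simp add: dsr_coord_def dsr_basis_nth)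

lemma dsr_coord_series:
  assumes "0 < q" "q < 1" "0 < l"
  shows "dsr_coord q l (dsr_series q l a) n = a n"
  using dsr_const_pos[OF assms, of n] by (simp add: dsr_coord_def dsr_series_def)

lemma dsr_series_coord:
  assumes "0 < q" "q < 1" "0 < l"
  shows "dsr_series q l (dsr_coord q l g) = g"
proof (rule fps_ext)
  show "fps_nth (dsr_series q l (dsr_coord q l g)) n = fps_nth g n" for n
    using dsr_const_pos[OF assms, of n] by (simp add: dsr_coord_def dsr_series_def)
qed

lemma dsr_inner_basis:
  assumes "0 < q" "q < 1" "0 < l"
  shows "dsr_inner q l (dsr_basis q l m) (dsr_basis q l n) = (if m = n then 1 else 0)"
proof -
  have "(\<lambda>k. dsr_coord q l (dsr_basis q l m) k * cnj (dsr_coord q l (dsr_basis q l n) k))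
        = (\<lambda>k. if k = m then (if m = n then 1 else 0) else 0)"
    by (auto simp: dsr_coord_basis[OF assms])
  thus ?thesis unfolding dsr_inner_def using sums_single[of m "\<lambda>_. if m = n then 1 else 0 :: complex"]
    by (simp add: sums_iff)
qed

lemma qpow_J0_basis:
  assumes "0 < q" "q < 1" "0 < l"
  shows "qpow_J0 q l c (dsr_basis q l n) = fps_const (of_real (q powr (c * (l + real n)))) * dsr_basis q l n"
  by (rule fps_ext)
     (simp add: qpow_J0_def dsr_series_def dsr_coord_basis[OF assms] dsr_basis_nth)

lemma J_plus_basis:
  assumes "0 < q" "q < 1" "0 < l"
  shows "J_plus q l (dsr_basis q l n) =
    fps_const (of_real (sqrt (qnum q (2 * l + real n) * qnum q (real n + 1)))) * dsr_basis q l (n + 1)"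
  by (rule fps_ext)
     (auto simp: J_plus_def dsr_series_def dsr_coord_basis[OF assms] dsr_basis_nth split: nat.splits)

lemma J_minus_basis:
  assumes "0 < q" "q < 1" "0 < l"
  shows "J_minus q l (dsr_basis q l n) =
    fps_const (of_real (sqrt (qnum q (2 * l + real n - 1) * qnum q (real n)))) * dsr_basis q l (n - 1)"
proof (cases n)
  case 0
  then show ?thesis
    by (intro fps_ext) (simp add: J_minus_def dsr_series_def dsr_coord_basis[OF assms] qnum_def)
next
  case (Suc m)
  then show ?thesis
    by (intro fps_ext)
       (simp add: J_minus_def dsr_series_def dsr_coord_basis[OF assms] dsr_basis_nth algebra_simps)
qed

end

theory Submission
  imports Defs
begin

text \<open>
  In the orthonormal basis, \<open>I\<^sub>1 = B (1 - M)\<close> with \<open>B = (q\<^bsup>-1/2\<^esup> - q\<^bsup>1/2\<^esup>)\<^sup>-\<^sup>1\<close>, where \<open>M\<close> is, up to phases, the Jacobi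
  matrix of the Al-Salam--Chihara polynomials with parameters \<open>\<alpha> = q\<^bsup>l + 1/4\<^esup>\<close> and \<open>\<beta> = q\<^bsup>l - 1/4\<^esup>\<close>.
  The formal eigenvalue equation is a three-term recurrence, equivalently a first order
  \<open>q\<close>-difference equation for the power series, and iterating the latter gives the quotient of
  infinite products. Since the entries of \<open>M\<close> converge geometrically to those of the free Jacobi
  matrix, truncated plane waves are approximate eigenvectors for every point of the interval.
  Conversely, for \<open>l \<ge> 1/4\<close> both parameters are at most 1, the numerical range of \<open>I\<^sub>1\<close> lies in
  \<open>[0, 2 B]\<close>, and outside of it \<open>I\<^sub>1 - z\<close> is coercive and hence invertible. The first basis vector
  is cyclic because no off-diagonal entry vanishes.
\<close>

subsection \<open>Square-summable sequences\<close>

text \<open>The bound \<open>1 / 4 \<le> l\<close> marks a real change in the spectrum. For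
  \<open>l < 1 / 4\<close> the parameter \<beta> exceeds 1, and at exp (i \<theta>) = \<beta> a
  numerator factor of the eigenfunction cancels one of the denominator. The coordinates of the
  remaining series decay like \<beta>^(-n), so it lies in the Hilbert space, and its eigenvalue B (1
  - (\<beta> + 1/\<beta>) / 2) is negative. Thus the interval lies in the spectrum for every
  \<open>l > 0\<close>, while equality can be claimed only from 1/4 on. The Hilbert space is a set
  of formal series, not a normed type. The analysis is therefore done on coordinate sequences by
  means of finite partial sums and carried back along \<open>dsr_coord\<close>, which intertwines
  \<open>I1\<close> with a Jacobi matrix on all formal series.\<close>

definition ell2 :: "(nat \<Rightarrow> complex) set" where
  "ell2 = {u. summable (\<lambda>n. (cmod (u n))\<^sup>2)}"

definition ell2_norm :: "(nat \<Rightarrow> complex) \<Rightarrow> real" where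
  "ell2_norm u = sqrt (\<Sum>n. (cmod (u n))\<^sup>2)"

lemma ell2_norm_nonneg [simp]: "u \<in> ell2 \<Longrightarrow> 0 \<le> ell2_norm u"
  by (simp add: ell2_norm_def ell2_def suminf_nonneg)

lemma ell2_norm_square: "u \<in> ell2 \<Longrightarrow> (ell2_norm u)\<^sup>2 = (\<Sum>n. (cmod (u n))\<^sup>2)"
  by (simp add: ell2_norm_def ell2_def suminf_nonneg)

lemma ell2_norm_sums: "u \<in> ell2 \<Longrightarrow> (\<lambda>n. (cmod (u n))\<^sup>2) sums (ell2_norm u)\<^sup>2"
  by (simp add: ell2_norm_square) (simp add: ell2_def summable_sums)

lemma ell2_mult_summable:
  assumes "u \<in> ell2" "v \<in> ell2"
  shows "summable (\<lambda>n. cmod (u n) * cmod (v n))"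
proof (rule summable_comparison_test')
  show "summable (\<lambda>n. (cmod (u n))\<^sup>2 + (cmod (v n))\<^sup>2)"
    using assms by (intro summable_add) (auto simp: ell2_def)
next
  fix n
  have "2 * (cmod (u n) * cmod (v n)) \<le> (cmod (u n))\<^sup>2 + (cmod (v n))\<^sup>2"
    using sum_squares_bound[of "cmod (u n)" "cmod (v n)"] by simp
  moreover have "0 \<le> cmod (u n) * cmod (v n)"
    by simp
  ultimately show "norm (cmod (u n) * cmod (v n)) \<le> (cmod (u n))\<^sup>2 + (cmod (v n))\<^sup>2"
    unfolding real_norm_def by linarith
qed

text \<open>A uniform bound on partial sums yields membership and the norm estimate together, so the
  later estimates are proved on finite sums.\<close>

lemma ell2_boundI:
  assumes "\<And>N. (\<Sum>n<N. (cmod (u n))\<^sup>2) \<le> c\<^sup>2" "0 \<le> c"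
  shows "u \<in> ell2" "ell2_norm u \<le> c"
proof -
  show u: "u \<in> ell2"
    unfolding ell2_def mem_Collect_eq
    by (rule summableI_nonneg_bounded[where x = "c\<^sup>2"]) (use assms in auto)
  have "(\<Sum>n. (cmod (u n))\<^sup>2) \<le> c\<^sup>2"
    by (rule suminf_le_const) (use u assms in \<open>auto simp: ell2_def\<close>)
  thus "ell2_norm u \<le> c"
    unfolding ell2_norm_def using assms(2) by (rule real_le_lsqrt[rotated])
qed

lemma ell2_partial_sum_le: "u \<in> ell2 \<Longrightarrow> (\<Sum>n<N. (cmod (u n))\<^sup>2) \<le> (ell2_norm u)\<^sup>2"
  unfolding ell2_norm_square by (rule sum_le_suminf) (auto simp: ell2_def)

lemma norm_le_ell2_norm:
  assumes "u \<in> ell2"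
  shows "cmod (u n) \<le> ell2_norm u"
proof -
  have "(cmod (u n))\<^sup>2 \<le> (\<Sum>k<Suc n. (cmod (u k))\<^sup>2)"
    by (simp add: sum_nonneg)
  also have "\<dots> \<le> (ell2_norm u)\<^sup>2"
    using assms by (rule ell2_partial_sum_le)
  finally show ?thesis
    using assms by (simp add: power2_le_iff_abs_le)
qed

lemma ell2_mono:
  assumes "u \<in> ell2" "0 \<le> c" "\<And>n. cmod (v n) \<le> c * cmod (u n)"
  shows "v \<in> ell2" "ell2_norm v \<le> c * ell2_norm u"
proof -
  have "(\<Sum>n<N. (cmod (v n))\<^sup>2) \<le> (c * ell2_norm u)\<^sup>2" for N
  proof -
    have "(\<Sum>n<N. (cmod (v n))\<^sup>2) \<le> (\<Sum>n<N. (c * cmod (u n))\<^sup>2)"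
      by (intro sum_mono power_mono assms) auto
    also have "\<dots> = c\<^sup>2 * (\<Sum>n<N. (cmod (u n))\<^sup>2)"
      by (simp add: power_mult_distrib sum_distrib_left)
    also have "\<dots> \<le> (c * ell2_norm u)\<^sup>2"
      unfolding power_mult_distrib using ell2_partial_sum_le[OF assms(1)]
      by (intro mult_left_mono) auto
    finally show ?thesis .
  qed
  from ell2_boundI[OF this] assms show "v \<in> ell2" "ell2_norm v \<le> c * ell2_norm u"
    by auto
qed

lemma ell2_cmult:
  assumes "u \<in> ell2"
  shows "(\<lambda>n. c * u n) \<in> ell2" "ell2_norm (\<lambda>n. c * u n) \<le> cmod c * ell2_norm u"
  using ell2_mono[OF assms, of "cmod c" "\<lambda>n. c * u n"] by (auto simp: norm_mult)

lemma ell2_add: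
  assumes u: "u \<in> ell2" and v: "v \<in> ell2"
  shows "(\<lambda>n. u n + v n) \<in> ell2" "ell2_norm (\<lambda>n. u n + v n) \<le> ell2_norm u + ell2_norm v"
proof -
  have *: "L2_set (\<lambda>n. cmod (w n)) {..<N} \<le> ell2_norm w" if "w \<in> ell2" for w N
    unfolding L2_set_def using ell2_partial_sum_le[OF that] that by (intro real_le_lsqrt) auto
  have "(\<Sum>n<N. (cmod (u n + v n))\<^sup>2) \<le> (ell2_norm u + ell2_norm v)\<^sup>2" for N
  proof -
    have "L2_set (\<lambda>n. cmod (u n + v n)) {..<N} \<le> L2_set (\<lambda>n. cmod (u n) + cmod (v n)) {..<N}"
      by (intro L2_set_mono norm_triangle_ineq) auto
    also have "\<dots> \<le> L2_set (\<lambda>n. cmod (u n)) {..<N} + L2_set (\<lambda>n. cmod (v n)) {..<N}"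
      by (rule L2_set_triangle_ineq)
    also have "\<dots> \<le> ell2_norm u + ell2_norm v"
      using *[OF u] *[OF v] by (rule add_mono)
    finally have "(L2_set (\<lambda>n. cmod (u n + v n)) {..<N})\<^sup>2 \<le> (ell2_norm u + ell2_norm v)\<^sup>2"
      by (intro power_mono) auto
    thus ?thesis
      by (simp add: L2_set_def sum_nonneg)
  qed
  from ell2_boundI[OF this] u v show "(\<lambda>n. u n + v n) \<in> ell2"
      "ell2_norm (\<lambda>n. u n + v n) \<le> ell2_norm u + ell2_norm v"
    by auto
qed

lemma ell2_diff:
  assumes "u \<in> ell2" "v \<in> ell2"
  shows "(\<lambda>n. u n - v n) \<in> ell2"
  using ell2_add(1)[OF assms(1) ell2_cmult(1)[OF assms(2), of "-1"]] by simp

lemma ell2_shift_left: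
  assumes "u \<in> ell2"
  shows "(\<lambda>n. u (Suc n)) \<in> ell2" "ell2_norm (\<lambda>n. u (Suc n)) \<le> ell2_norm u"
proof -
  have "(\<Sum>n<N. (cmod (u (Suc n)))\<^sup>2) \<le> (ell2_norm u)\<^sup>2" for N
    using ell2_partial_sum_le[OF assms, of "Suc N"] unfolding sum.lessThan_Suc_shift
    by (rule order_trans[rotated]) simp
  from ell2_boundI[OF this] assms show "(\<lambda>n. u (Suc n)) \<in> ell2"
      "ell2_norm (\<lambda>n. u (Suc n)) \<le> ell2_norm u"
    by auto
qed

lemma ell2_shift_right:
  assumes "u \<in> ell2"
  shows "case_nat 0 u \<in> ell2" "ell2_norm (case_nat 0 u) \<le> ell2_norm u"
proof -
  have "(\<Sum>n<N. (cmod (case_nat 0 u n))\<^sup>2) \<le> (ell2_norm u)\<^sup>2" for N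
  proof (cases N)
    case (Suc M)
    show ?thesis
      using ell2_partial_sum_le[OF assms, of M] unfolding Suc sum.lessThan_Suc_shift by simp
  qed simp
  from ell2_boundI[OF this] assms show "case_nat 0 u \<in> ell2"
      "ell2_norm (case_nat 0 u) \<le> ell2_norm u"
    by auto
qed

text \<open>A Fatou argument: each partial sum has finitely many terms and so passes to the limit.
  This stands in for completeness when a series of vectors is summed coordinatewise.\<close>

lemma ell2_pointwise_limit:
  assumes "\<And>n. (\<lambda>k. f k n) \<longlonglongrightarrow> s n" "\<And>k. f k \<in> ell2" "\<And>k. ell2_norm (f k) \<le> c"
  shows "s \<in> ell2" "ell2_norm s \<le> c"
proof -
  have c: "0 \<le> c"
    using order_trans[OF ell2_norm_nonneg[OF assms(2)] assms(3)] .
  have "(\<Sum>n<N. (cmod (s n))\<^sup>2) \<le> c\<^sup>2" for N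
  proof (rule LIMSEQ_le_const2)
    show "(\<lambda>k. \<Sum>n<N. (cmod (f k n))\<^sup>2) \<longlonglongrightarrow> (\<Sum>n<N. (cmod (s n))\<^sup>2)"
      by (intro tendsto_intros assms)
    have "(\<Sum>n<N. (cmod (f k n))\<^sup>2) \<le> c\<^sup>2" for k
      using ell2_partial_sum_le[OF assms(2)] power_mono[OF assms(3) ell2_norm_nonneg[OF assms(2)]]
      by (rule order_trans)
    thus "\<exists>K. \<forall>k\<ge>K. (\<Sum>n<N. (cmod (f k n))\<^sup>2) \<le> c\<^sup>2"
      by blast
  qed
  from ell2_boundI[OF this c] show "s \<in> ell2" "ell2_norm s \<le> c" .
qed

subsection \<open>Bounded Jacobi matrices\<close>

text \<open>\<open>a n\<close> couples sites n and n+1 and its conjugate sits below the diagonal, so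
  the matrix is Hermitian. Rows are finite, so it acts on arbitrary sequences.\<close>

definition jacobi :: "(nat \<Rightarrow> real) \<Rightarrow> (nat \<Rightarrow> complex) \<Rightarrow> (nat \<Rightarrow> complex) \<Rightarrow> nat \<Rightarrow> complex" where
  "jacobi d a u n = of_real (d n) * u n + a n * u (Suc n)
     + (case n of 0 \<Rightarrow> 0 | Suc m \<Rightarrow> cnj (a m) * u m)"

lemma jacobi_add: "jacobi d a (\<lambda>n. u n + v n) = (\<lambda>n. jacobi d a u n + jacobi d a v n)"
  by (rule ext) (auto simp: jacobi_def algebra_simps split: nat.splits)

lemma jacobi_cmult: "jacobi d a (\<lambda>n. c * u n) = (\<lambda>n. c * jacobi d a u n)"
  by (rule ext) (auto simp: jacobi_def algebra_simps split: nat.splits)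

lemma jacobi_sums:
  assumes "\<And>n. (\<lambda>k. f k n) sums s n"
  shows "(\<lambda>k. jacobi d a (f k) n) sums jacobi d a s n"
  unfolding jacobi_def
  by (cases n) (auto intro!: sums_add sums_mult assms)

locale bounded_jacobi =
  fixes d :: "nat \<Rightarrow> real" and a :: "nat \<Rightarrow> complex" and C :: real
  assumes diag_bound: "\<bar>d n\<bar> \<le> C" and offdiag_bound: "cmod (a n) \<le> C"
begin

lemma bound_nonneg: "0 \<le> C"
  using order_trans[OF abs_ge_zero diag_bound] .

lemma jacobi_bounded:
  assumes u: "u \<in> ell2"
  shows "jacobi d a u \<in> ell2" "ell2_norm (jacobi d a u) \<le> 3 * C * ell2_norm u"
proof -
  let ?f = "\<lambda>n. of_real (d n) * u n" and ?g = "\<lambda>n. a n * u (Suc n)"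
    and ?h = "\<lambda>n. cnj (a n) * u n"
  have f: "?f \<in> ell2" "ell2_norm ?f \<le> C * ell2_norm u"
    by (rule ell2_mono[OF u bound_nonneg]; simp add: norm_mult mult_right_mono diag_bound)+
  have h: "?h \<in> ell2" "ell2_norm ?h \<le> C * ell2_norm u"
    by (rule ell2_mono[OF u bound_nonneg]; simp add: norm_mult mult_right_mono offdiag_bound)+
  have g: "?g \<in> ell2" "ell2_norm ?g \<le> C * ell2_norm (\<lambda>n. u (Suc n))"
    by (rule ell2_mono[OF ell2_shift_left(1)[OF u] bound_nonneg];
        simp add: norm_mult mult_right_mono offdiag_bound)+
  have g': "C * ell2_norm (\<lambda>n. u (Suc n)) \<le> C * ell2_norm u"
    by (intro mult_left_mono ell2_shift_left u bound_nonneg)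
  have eq: "jacobi d a u = (\<lambda>n. (?f n + ?g n) + case_nat 0 ?h n)"
    by (rule ext) (simp add: jacobi_def)
  show "jacobi d a u \<in> ell2"
    unfolding eq by (intro ell2_add ell2_shift_right f g h)
  have "ell2_norm (jacobi d a u) \<le> (ell2_norm ?f + ell2_norm ?g) + ell2_norm (case_nat 0 ?h)"
    unfolding eq using ell2_add(2)[OF ell2_add(1)[OF f(1) g(1)] ell2_shift_right(1)[OF h(1)]]
      ell2_add(2)[OF f(1) g(1)] by linarith
  thus "ell2_norm (jacobi d a u) \<le> 3 * C * ell2_norm u"
    using f(2) g(2) g' h(2) ell2_shift_right(2)[OF h(1)] by linarith
qed

text \<open>After an index shift, the subdiagonal part is the conjugate of the superdiagonal part
  with u and v exchanged. This form of the value makes symmetry immediate.\<close>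

lemma jacobi_form_sums:
  assumes u: "u \<in> ell2" and v: "v \<in> ell2"
  shows "(\<lambda>n. jacobi d a u n * cnj (v n)) sums
    ((\<Sum>n. of_real (d n) * u n * cnj (v n)) + (\<Sum>n. a n * u (Suc n) * cnj (v n))
      + cnj (\<Sum>n. a n * v (Suc n) * cnj (u n)))"
proof -
  have diag: "summable (\<lambda>n. of_real (d n) * u n * cnj (v n))"
  proof (rule summable_comparison_test')
    show "summable (\<lambda>n. C * (cmod (u n) * cmod (v n)))"
      by (intro summable_mult ell2_mult_summable u v)
  qed (simp add: norm_mult mult.assoc mult_right_mono diag_bound)
  have off: "summable (\<lambda>n. a n * u (Suc n) * cnj (v n))" if "u \<in> ell2" "v \<in> ell2" for u v
  proof (rule summable_comparison_test')
    show "summable (\<lambda>n. C * (cmod (u (Suc n)) * cmod (v n)))"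
      by (intro summable_mult ell2_mult_summable that ell2_shift_left)
  qed (simp add: norm_mult mult.assoc mult_right_mono offdiag_bound)
  have "(\<lambda>n. cnj (a n * v (Suc n) * cnj (u n))) sums cnj (\<Sum>n. a n * v (Suc n) * cnj (u n))"
    unfolding sums_cnj by (intro summable_sums off u v)
  hence "(\<lambda>n. (case Suc n of 0 \<Rightarrow> 0 | Suc m \<Rightarrow> cnj (a m) * u m) * cnj (v (Suc n)))
      sums cnj (\<Sum>n. a n * v (Suc n) * cnj (u n))"
    by (simp add: mult_ac)
  from sums_Suc[OF this] have "(\<lambda>n. (case n of 0 \<Rightarrow> 0 | Suc m \<Rightarrow> cnj (a m) * u m) * cnj (v n))
      sums cnj (\<Sum>n. a n * v (Suc n) * cnj (u n))"
    by simp
  from sums_add[OF sums_add[OF summable_sums[OF diag] summable_sums[OF off[OF u v]]] this]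
  show ?thesis
    by (simp add: jacobi_def algebra_simps)
qed

lemma jacobi_symmetric:
  assumes u: "u \<in> ell2" and v: "v \<in> ell2"
  shows "(\<Sum>n. jacobi d a u n * cnj (v n)) = (\<Sum>n. u n * cnj (jacobi d a v n))"
proof -
  have "(\<lambda>n. u n * cnj (jacobi d a v n)) sums
      cnj ((\<Sum>n. of_real (d n) * v n * cnj (u n)) + (\<Sum>n. a n * v (Suc n) * cnj (u n))
        + cnj (\<Sum>n. a n * u (Suc n) * cnj (v n)))"
    by (subst sums_cnj[symmetric]) (use jacobi_form_sums[OF v u] in \<open>simp add: mult.commute\<close>)
  moreover have "cnj (\<Sum>n. of_real (d n) * v n * cnj (u n)) = (\<Sum>n. of_real (d n) * u n * cnj (v n))"
  proof -
    have "summable (\<lambda>n. of_real (d n) * v n * cnj (u n))"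
    proof (rule summable_comparison_test')
      show "summable (\<lambda>n. C * (cmod (v n) * cmod (u n)))"
        by (intro summable_mult ell2_mult_summable u v)
    qed (simp add: norm_mult mult.assoc mult_right_mono diag_bound)
    hence "(\<lambda>n. cnj (of_real (d n) * v n * cnj (u n))) sums cnj (\<Sum>n. of_real (d n) * v n * cnj (u n))"
      unfolding sums_cnj by (rule summable_sums)
    from sums_unique[OF this] show ?thesis
      by (simp add: mult_ac)
  qed
  ultimately show ?thesis
    using jacobi_form_sums[OF u v] by (simp add: sums_iff add_ac)
qed

text \<open>A weighted AM-GM (Schur) estimate: the coupling of sites n and n+1 is charged with
  weight \<open>X n\<close> to its left end and \<open>Y (Suc n)\<close> to its right end. Site n
  then pays \<open>X n + Y n\<close> in addition to its diagonal entry.\<close>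

lemma jacobi_form_bound:
  fixes X Y :: "nat \<Rightarrow> real"
  assumes u: "u \<in> ell2"
    and nonneg: "\<And>n. 0 \<le> X n" "\<And>n. 0 \<le> Y n"
    and am_gm: "\<And>n. (cmod (a n))\<^sup>2 \<le> X n * Y (Suc n)"
    and K: "\<And>n. X n + Y n + d n \<le> K"
  shows "Re (\<Sum>n. jacobi d a u n * cnj (u n)) \<le> K * (ell2_norm u)\<^sup>2"
proof -
  let ?o = "\<lambda>n. a n * u (Suc n) * cnj (u n)"
  have sq: "summable (\<lambda>n. (cmod (u n))\<^sup>2)"
    using u by (simp add: ell2_def)
  have XK: "X n \<le> K + C" "Y n \<le> K + C" for n
    using K[of n] nonneg(1)[of n] nonneg(2)[of n] diag_bound[of n] by linarith+
  have sX: "summable (\<lambda>n. X n * (cmod (u n))\<^sup>2)"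
    by (rule summable_comparison_test'[OF summable_mult[OF sq, of "K + C"]])
       (auto simp: abs_mult nonneg intro!: mult_right_mono XK)
  have sY: "summable (\<lambda>n. Y n * (cmod (u n))\<^sup>2)"
    by (rule summable_comparison_test'[OF summable_mult[OF sq, of "K + C"]])
       (auto simp: abs_mult nonneg intro!: mult_right_mono XK)
  have sY': "summable (\<lambda>n. Y (Suc n) * (cmod (u (Suc n)))\<^sup>2)"
    using sY summable_Suc_iff[of "\<lambda>n. Y n * (cmod (u n))\<^sup>2"] by simp
  have so: "summable ?o"
  proof (rule summable_comparison_test')
    show "summable (\<lambda>n. C * (cmod (u (Suc n)) * cmod (u n)))"
      by (intro summable_mult ell2_mult_summable u ell2_shift_left)
  qed (simp add: norm_mult mult.assoc mult_right_mono offdiag_bound)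
  have sd: "summable (\<lambda>n. d n * (cmod (u n))\<^sup>2)"
    by (rule summable_comparison_test'[OF summable_mult[OF sq, of C]])
       (auto simp: abs_mult intro!: mult_right_mono diag_bound)
  have "(\<lambda>n. complex_of_real (d n * (cmod (u n))\<^sup>2)) sums of_real (\<Sum>n. d n * (cmod (u n))\<^sup>2)"
    unfolding sums_of_real_iff using sd by (rule summable_sums)
  hence diag: "(\<Sum>n. of_real (d n) * u n * cnj (u n)) = of_real (\<Sum>n. d n * (cmod (u n))\<^sup>2)"
    by (simp add: sums_iff mult.assoc complex_norm_square[symmetric])
  have "2 * Re (?o n) \<le> X n * (cmod (u n))\<^sup>2 + Y (Suc n) * (cmod (u (Suc n)))\<^sup>2" for n
  proof -
    have "Re (?o n) \<le> cmod (a n) * (cmod (u (Suc n)) * cmod (u n))"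
      using complex_Re_le_cmod[of "?o n"] by (simp add: norm_mult mult.assoc)
    also have "\<dots> \<le> sqrt (X n * Y (Suc n)) * (cmod (u (Suc n)) * cmod (u n))"
      using am_gm by (intro mult_right_mono real_le_rsqrt) auto
    also have "\<dots> = (sqrt (X n) * cmod (u n)) * (sqrt (Y (Suc n)) * cmod (u (Suc n)))"
      by (simp add: real_sqrt_mult)
    finally have "2 * Re (?o n) \<le> 2 * (sqrt (X n) * cmod (u n)) * (sqrt (Y (Suc n)) * cmod (u (Suc n)))"
      by simp
    also have "\<dots> \<le> (sqrt (X n) * cmod (u n))\<^sup>2 + (sqrt (Y (Suc n)) * cmod (u (Suc n)))\<^sup>2"
      by (rule sum_squares_bound)
    finally show ?thesis
      by (simp add: power_mult_distrib nonneg)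
  qed
  hence "(\<Sum>n. 2 * Re (?o n)) \<le> (\<Sum>n. X n * (cmod (u n))\<^sup>2 + Y (Suc n) * (cmod (u (Suc n)))\<^sup>2)"
    using so sX sY'
    by (intro suminf_le summable_add summable_mult summable_Re)
  also have "\<dots> = (\<Sum>n. X n * (cmod (u n))\<^sup>2) + (\<Sum>n. Y (Suc n) * (cmod (u (Suc n)))\<^sup>2)"
    using sX sY' by (rule suminf_add[symmetric])
  \<comment> \<open>Site 0 has no left neighbour, so the term of \<open>Y 0\<close> is only added to
    complete the sum.\<close>
  also have "(\<Sum>n. Y (Suc n) * (cmod (u (Suc n)))\<^sup>2) \<le> (\<Sum>n. Y n * (cmod (u n))\<^sup>2)"
    using suminf_split_head[OF sY] nonneg(2)[of 0] by simp
  also have "(\<Sum>n. X n * (cmod (u n))\<^sup>2) + (\<Sum>n. Y n * (cmod (u n))\<^sup>2)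
      = (\<Sum>n. X n * (cmod (u n))\<^sup>2 + Y n * (cmod (u n))\<^sup>2)"
    using sX sY by (rule suminf_add)
  also have "\<dots> \<le> (\<Sum>n. K * (cmod (u n))\<^sup>2 - d n * (cmod (u n))\<^sup>2)"
  proof (intro suminf_le summable_add summable_diff summable_mult sX sY sq sd)
    show "X n * (cmod (u n))\<^sup>2 + Y n * (cmod (u n))\<^sup>2 \<le> K * (cmod (u n))\<^sup>2 - d n * (cmod (u n))\<^sup>2" for n
      using mult_right_mono[OF K[of n], of "(cmod (u n))\<^sup>2"] by (simp add: algebra_simps)
  qed
  also have "\<dots> = K * (ell2_norm u)\<^sup>2 - (\<Sum>n. d n * (cmod (u n))\<^sup>2)"
    using suminf_diff[OF summable_mult[OF sq] sd, of K] suminf_mult[OF sq, of K] ell2_norm_square[OF u] by simp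
  also have "(\<Sum>n. 2 * Re (?o n)) = 2 * Re (suminf ?o)"
    using so by (subst suminf_mult) (simp_all add: summable_Re bounded_linear.suminf[OF bounded_linear_Re] del: times_complex.sel)
  finally show ?thesis
    using jacobi_form_sums[OF u u] diag by (simp add: sums_iff)
qed

section \<open>Coercivity and inversion of J - z\<close>

lemma resolvent_form_sums:
  assumes u: "u \<in> ell2"
  shows "(\<lambda>n. (jacobi d a u n - z * u n) * cnj (u n)) sums
    ((\<Sum>n. jacobi d a u n * cnj (u n)) - z * of_real ((ell2_norm u)\<^sup>2))"
proof -
  have "(\<lambda>n. complex_of_real ((cmod (u n))\<^sup>2)) sums of_real ((ell2_norm u)\<^sup>2)"
    unfolding sums_of_real_iff using u by (rule ell2_norm_sums)
  from sums_diff[OF summable_sums[OF sums_summable[OF jacobi_form_sums[OF u u]]] sums_mult[OF this, of z]]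
  show ?thesis
    by (simp add: left_diff_distrib mult.assoc flip: complex_norm_square)
qed

lemma resolvent_bounded:
  assumes u: "u \<in> ell2"
  shows "(\<lambda>n. jacobi d a u n - z * u n) \<in> ell2"
    "ell2_norm (\<lambda>n. jacobi d a u n - z * u n) \<le> (3 * C + cmod z) * ell2_norm u"
proof -
  note J = jacobi_bounded[OF u] and Z = ell2_cmult[OF u, of "-z"]
  show "(\<lambda>n. jacobi d a u n - z * u n) \<in> ell2"
    by (intro ell2_diff J ell2_cmult u)
  show "ell2_norm (\<lambda>n. jacobi d a u n - z * u n) \<le> (3 * C + cmod z) * ell2_norm u"
    using ell2_add(2)[OF J(1) Z(1)] J(2) Z(2) by (simp add: algebra_simps)
qed

lemma coercive_inj:
  assumes "0 < c"
    and coercive: "\<And>u. u \<in> ell2 \<Longrightarrow> c * (ell2_norm u)\<^sup>2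
      \<le> Re (\<zeta> * ((\<Sum>n. jacobi d a u n * cnj (u n)) - z * of_real ((ell2_norm u)\<^sup>2)))"
    and "u \<in> ell2" "v \<in> ell2"
    and eq: "\<And>n. jacobi d a u n - z * u n = jacobi d a v n - z * v n"
  shows "u = v"
proof
  fix n
  let ?w = "\<lambda>n. u n - v n"
  have w: "?w \<in> ell2"
    using assms by (intro ell2_diff)
  have "jacobi d a ?w = (\<lambda>n. jacobi d a u n - jacobi d a v n)"
    using jacobi_add[of d a u "\<lambda>n. - 1 * v n"] jacobi_cmult[of d a "-1" v] by simp
  hence "jacobi d a ?w n - z * ?w n = 0" for n
    using eq[of n] by (simp add: algebra_simps)
  hence "(\<Sum>n. jacobi d a ?w n * cnj (?w n)) - z * of_real ((ell2_norm ?w)\<^sup>2) = 0"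
    using resolvent_form_sums[OF w, of z] by (simp add: sums_iff)
  with coercive[OF w] have "c * (ell2_norm ?w)\<^sup>2 \<le> 0"
    by simp
  hence "ell2_norm ?w = 0"
    using \<open>0 < c\<close> by (simp add: mult_le_0_iff)
  with norm_le_ell2_norm[OF w, of n] show "u n = v n"
    by simp
qed

text \<open>
  The map \<open>S = 1 - \<rho> \<zeta> (J - z)\<close> is a contraction for small \<open>\<rho>\<close>. Because \<open>J\<close> has finitely many entries
  in each row, the Neumann series of \<open>S\<close> may be summed coordinatewise, so that completeness
  of the space is not needed.
\<close>

lemma coercive_surj:
  assumes c: "0 < c" and \<zeta>: "cmod \<zeta> = 1"
    and coercive: "\<And>u. u \<in> ell2 \<Longrightarrow> c * (ell2_norm u)\<^sup>2
      \<le> Re (\<zeta> * ((\<Sum>n. jacobi d a u n * cnj (u n)) - z * of_real ((ell2_norm u)\<^sup>2)))"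
  shows "\<exists>K. \<forall>g\<in>ell2. \<exists>u\<in>ell2. ell2_norm u \<le> K * ell2_norm g
    \<and> (\<forall>n. jacobi d a u n - z * u n = g n)"
proof -
  \<comment> \<open>L bounds the norm of J - z, and the extra c gives \<open>c \<le> L\<close>, so
    the root defining k is real. The choice \<open>\<rho> = c / L^2\<close> minimizes 1 - 2 \<rho> c
    + \<rho>^2 L^2, and the minimum is k^2.\<close>
  define L where "L = 3 * C + cmod z + c"
  define \<rho> where "\<rho> = c / L\<^sup>2"
  define k where "k = sqrt (1 - c\<^sup>2 / L\<^sup>2)"
  define T where "T u = (\<lambda>n. jacobi d a u n - z * u n)" for u
  define S where "S u = (\<lambda>n. u n - of_real \<rho> * \<zeta> * T u n)" for u
  have L: "0 < L" "c \<le> L"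
    using bound_nonneg c by (auto simp: L_def add_nonneg_pos)
  have \<rho>: "0 < \<rho>"
    using c L by (simp add: \<rho>_def)
  have cL: "c\<^sup>2 / L\<^sup>2 \<le> 1" "0 < c\<^sup>2 / L\<^sup>2"
    using c L by (auto simp: divide_le_eq_1 intro: power_mono)
  have k: "0 \<le> k" "k < 1" "k\<^sup>2 = 1 - c\<^sup>2 / L\<^sup>2"
    using cL by (auto simp: k_def)
  have T_ell2: "T u \<in> ell2" and T_norm: "ell2_norm (T u) \<le> L * ell2_norm u" if u: "u \<in> ell2" for u
  proof -
    show "T u \<in> ell2"
      unfolding T_def by (rule resolvent_bounded[OF u])
    have "(3 * C + cmod z) * ell2_norm u \<le> L * ell2_norm u"
      using c u by (intro mult_right_mono) (auto simp: L_def)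
    with resolvent_bounded(2)[OF u, of z] show "ell2_norm (T u) \<le> L * ell2_norm u"
      unfolding T_def by linarith
  qed
  have S_ell2: "S u \<in> ell2" if u: "u \<in> ell2" for u
    unfolding S_def by (intro ell2_diff ell2_cmult T_ell2 u)
  have S_norm: "ell2_norm (S u) \<le> k * ell2_norm u" if u: "u \<in> ell2" for u
  proof -
    let ?F = "(\<Sum>n. jacobi d a u n * cnj (u n)) - z * of_real ((ell2_norm u)\<^sup>2)"
    \<comment> \<open>Expanding |u - \<rho> \<zeta> T u|^2 termwise turns the cross term into the
      form that coercivity controls from below.\<close>
    have "(\<lambda>n. (cmod (u n))\<^sup>2 - 2 * \<rho> * Re (\<zeta> * (T u n * cnj (u n))) + \<rho>\<^sup>2 * (cmod (T u n))\<^sup>2) sums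
        ((ell2_norm u)\<^sup>2 - 2 * \<rho> * Re (\<zeta> * ?F) + \<rho>\<^sup>2 * (ell2_norm (T u))\<^sup>2)"
      using resolvent_form_sums[OF u, of z] unfolding T_def[symmetric]
      by (intro sums_add sums_diff sums_mult sums_Re ell2_norm_sums u T_ell2)
         (simp add: T_def)
    moreover have "(cmod (S u n))\<^sup>2 = (cmod (u n))\<^sup>2 - 2 * \<rho> * Re (\<zeta> * (T u n * cnj (u n)))
        + \<rho>\<^sup>2 * (cmod (T u n))\<^sup>2" for n
    proof -
      have *: "(cmod (x - y))\<^sup>2 = (cmod x)\<^sup>2 - 2 * Re (y * cnj x) + (cmod y)\<^sup>2" for x y
        unfolding cmod_power2 by (simp add: power2_eq_square algebra_simps)
      have "Re (of_real \<rho> * \<zeta> * T u n * cnj (u n)) = \<rho> * Re (\<zeta> * (T u n * cnj (u n)))"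
      proof -
        have "Re (of_real \<rho> * w) = \<rho> * Re w" for w
          by simp
        thus ?thesis
          by (simp only: mult.assoc)
      qed
      moreover have "(cmod (of_real \<rho> * \<zeta> * T u n))\<^sup>2 = \<rho>\<^sup>2 * (cmod (T u n))\<^sup>2"
        using \<zeta> by (simp add: norm_mult power_mult_distrib)
      ultimately show ?thesis
        unfolding S_def * by simp
    qed
    ultimately have "(ell2_norm (S u))\<^sup>2
        = (ell2_norm u)\<^sup>2 - 2 * \<rho> * Re (\<zeta> * ?F) + \<rho>\<^sup>2 * (ell2_norm (T u))\<^sup>2"
      using ell2_norm_sums[OF S_ell2[OF u]] by (simp add: sums_iff)
    also have "\<dots> \<le> (ell2_norm u)\<^sup>2 - 2 * \<rho> * (c * (ell2_norm u)\<^sup>2) + \<rho>\<^sup>2 * (L * ell2_norm u)\<^sup>2"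
      using \<rho> L u coercive[OF u] T_norm[OF u] T_ell2[OF u]
      by (intro add_mono diff_mono mult_left_mono power_mono) auto
    also have "\<dots> = (k * ell2_norm u)\<^sup>2"
      unfolding power_mult_distrib k(3) \<rho>_def using L by (simp add: field_simps power2_eq_square)
    finally show ?thesis
      using k u by (simp add: power2_le_iff_abs_le)
  qed
  have S_sums: "(\<lambda>j. S (f j) n) sums S s n" if "\<And>n. (\<lambda>j. f j n) sums s n" for f s n
    unfolding S_def T_def by (intro sums_diff sums_mult jacobi_sums that)
  have "\<exists>u\<in>ell2. ell2_norm u \<le> \<rho> / (1 - k) * ell2_norm g \<and> (\<forall>n. T u n = g n)"
    if g: "g \<in> ell2" for g
  proof -
    define f where "f j = (S ^^ j) g" for j
    have f_ell2: "f j \<in> ell2" for j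
      by (induction j) (auto simp: f_def g S_ell2)
    have f_norm: "ell2_norm (f j) \<le> k ^ j * ell2_norm g" for j
    proof (induction j)
      case (Suc j)
      have "ell2_norm (f (Suc j)) \<le> k * ell2_norm (f j)"
        using S_norm[OF f_ell2[of j]] by (simp add: f_def)
      also have "\<dots> \<le> k * (k ^ j * ell2_norm g)"
        using Suc k by (intro mult_left_mono) auto
      finally show ?case
        by simp
    qed (simp add: f_def)
    have summ: "summable (\<lambda>j. f j n)" for n
    proof (rule summable_comparison_test')
      show "summable (\<lambda>j. k ^ j * ell2_norm g)"
        using k by (intro summable_mult2 summable_geometric) auto
      show "cmod (f j n) \<le> k ^ j * ell2_norm g" for j
        using norm_le_ell2_norm[OF f_ell2] f_norm by (rule order_trans)
    qed
    define s where "s n = (\<Sum>j. f j n)" for n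
    have s: "(\<lambda>j. f j n) sums s n" for n
      unfolding s_def using summ by (rule summable_sums)
    have partial: "(\<lambda>n. \<Sum>j<J. f j n) \<in> ell2 \<and>
        ell2_norm (\<lambda>n. \<Sum>j<J. f j n) \<le> (\<Sum>j<J. k ^ j) * ell2_norm g" for J
    proof (induction J)
      case 0
      show ?case
        by (simp add: ell2_def ell2_norm_def)
    next
      case (Suc J)
      thus ?case
        using ell2_add[of "\<lambda>n. \<Sum>j<J. f j n" "f J"] f_ell2[of J] f_norm[of J]
        by (auto simp: distrib_right)
    qed
    have "(\<Sum>j<J. k ^ j) * ell2_norm g \<le> 1 / (1 - k) * ell2_norm g" for J
    proof (rule mult_right_mono)
      show "(\<Sum>j<J. k ^ j) \<le> 1 / (1 - k)"
        using sum_le_suminf[of "\<lambda>j. k ^ j" "{..<J}"] k by (simp add: suminf_geometric summable_geometric)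
    qed (simp add: g)
    hence norm_partial: "ell2_norm (\<lambda>n. \<Sum>j<J. f j n) \<le> 1 / (1 - k) * ell2_norm g" for J
      using partial[of J] by (meson order_trans)
    have s_ell2: "s \<in> ell2" and s_norm: "ell2_norm s \<le> 1 / (1 - k) * ell2_norm g"
      by (rule ell2_pointwise_limit[where f = "\<lambda>J n. \<Sum>j<J. f j n"];
          use s partial norm_partial in \<open>auto simp: sums_def\<close>)+
    \<comment> \<open>Dropping the first term of the Neumann series gives S s = s - g, that is
      \<rho> \<zeta> T s = g. Hence \<rho> \<zeta> s is the solution.\<close>
    have Ss: "S s n = s n - g n" for n
    proof -
      have "(\<lambda>j. f (Suc j) n) sums S s n"
        using S_sums[OF s] by (simp add: f_def)
      moreover have "(\<lambda>j. f (Suc j) n) sums (s n - f 0 n)"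
        using s[of n] sums_Suc_iff[of "\<lambda>j. f j n" "s n - f 0 n"] by simp
      ultimately show ?thesis
        using sums_unique2 by (fastforce simp: f_def)
    qed
    let ?u = "\<lambda>n. of_real \<rho> * \<zeta> * s n"
    have "T ?u n = g n" for n
    proof -
      have "T ?u n = of_real \<rho> * \<zeta> * T s n"
        unfolding T_def jacobi_cmult by (simp add: algebra_simps)
      also have "\<dots> = g n"
        using Ss[of n] by (simp add: S_def)
      finally show ?thesis .
    qed
    moreover have "?u \<in> ell2"
      by (intro ell2_cmult s_ell2)
    moreover have "ell2_norm ?u \<le> \<rho> / (1 - k) * ell2_norm g"
    proof -
      have "ell2_norm ?u \<le> \<rho> * ell2_norm s"
        using ell2_cmult(2)[OF s_ell2, of "of_real \<rho> * \<zeta>"] \<rho> \<zeta> by (simp add: norm_mult)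
      also have "\<dots> \<le> \<rho> * (1 / (1 - k) * ell2_norm g)"
        using \<rho> s_norm by (intro mult_left_mono) auto
      finally show ?thesis
        by simp
    qed
    ultimately show ?thesis
      by (intro bexI[of _ ?u]) auto
  qed
  thus ?thesis
    unfolding T_def by blast
qed

text \<open>The plane wave solves the limiting constant-coefficient recurrence exactly. Inside the
  support the defect is therefore geometrically small, and the ends contribute only at the sites 0,
  N - 1 and N. The residual stays bounded while the norm grows like sqrt N.\<close>

lemma approximate_eigenvectors:
  fixes N :: nat and \<zeta> :: complex
  assumes q: "0 < q" "q < 1" and \<zeta>: "cmod \<zeta> = 1"
    and diag: "\<And>n. \<bar>d n - D\<bar> \<le> E * q ^ n" and offdiag: "\<And>n. cmod (a n - \<kappa>) \<le> E * q ^ n"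
    and z: "z = of_real D + \<kappa> * \<zeta> + cnj \<kappa> * cnj \<zeta>"
  defines "u \<equiv> \<lambda>N n. if n < N then \<zeta> ^ n else 0"
  shows "u N \<in> ell2" "ell2_norm (u N) = sqrt N"
    "\<exists>K. \<forall>N. ell2_norm (\<lambda>n. jacobi d a (u N) n - z * u N n) \<le> K"
proof -
  have u_le: "cmod (u N n) \<le> 1" for N n
    by (simp add: u_def norm_power \<zeta>)
  have sq: "(cmod (u N n))\<^sup>2 = (if n \<in> {..<N} then 1 else 0)" for N n
    by (simp add: u_def norm_power \<zeta>)
  have sums: "(\<lambda>n. (cmod (u N n))\<^sup>2) sums of_nat N" for N
    using sums_If_finite_set[of "{..<N}" "\<lambda>_. 1 :: real"] unfolding sq by simp
  show "u N \<in> ell2"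
    using sums_summable[OF sums[of N]] by (simp add: ell2_def)
  show "ell2_norm (u N) = sqrt N"
    using sums_unique[OF sums[of N]] by (simp add: ell2_norm_def)
  define K where "K = 3 * C + cmod z"
  \<comment> \<open>Row n has two entries with error E q^n, while its subdiagonal entry has the
    error E q^(n-1).\<close>
  define E' where "E' = E * (2 + 1 / q)"
  define r where "r N n = jacobi d a (u N) n - z * u N n" for N n
  have E: "0 \<le> E"
    using order_trans[OF abs_ge_zero diag[of 0]] by simp
  have K: "0 \<le> K"
    using bound_nonneg by (simp add: K_def)
  have crude: "cmod (r N n) \<le> K" for N n
  proof -
    have "cmod (of_real (d n) * u N n) \<le> C" "cmod (a n * u N (Suc n)) \<le> C" "cmod (z * u N n) \<le> cmod z"
      using mult_mono[OF diag_bound[of n] u_le[of N n]] mult_mono[OF offdiag_bound[of n] u_le[of N "Suc n"]]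
        mult_left_mono[OF u_le[of N n], of "cmod z"] bound_nonneg
      by (simp_all add: norm_mult)
    moreover have "cmod (case n of 0 \<Rightarrow> 0 | Suc m \<Rightarrow> cnj (a m) * u N m) \<le> C"
      using bound_nonneg by (auto split: nat.splits simp: norm_mult intro!: mult_mono[OF offdiag_bound u_le, simplified])
    moreover have "cmod (w + x + y - v) \<le> cmod w + cmod x + cmod y + cmod v" for w x y v :: complex
      using norm_triangle_ineq4[of "w + x + y" v] norm_triangle_ineq[of "w + x" y] norm_triangle_ineq[of w x]
      by linarith
    ultimately show ?thesis
      unfolding r_def jacobi_def K_def by (fastforce intro: order_trans)
  qed
  have interior: "cmod (r N (Suc m)) \<le> E' * q ^ Suc m" if "Suc (Suc m) < N" for N m
  proof -
    have \<zeta>': "cnj \<zeta> * \<zeta> ^ Suc n = \<zeta> ^ n" for n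
      using complex_norm_square[of \<zeta>] \<zeta> by (simp add: mult.commute)
    have "r N (Suc m) = of_real (d (Suc m) - D) * \<zeta> ^ Suc m + (a (Suc m) - \<kappa>) * \<zeta> ^ Suc (Suc m)
        + cnj (a m - \<kappa>) * \<zeta> ^ m"
      using that \<zeta>'[of m] unfolding r_def jacobi_def u_def z
      by (simp add: algebra_simps)
    also have "cmod \<dots> \<le> cmod (of_real (d (Suc m) - D) * \<zeta> ^ Suc m)
        + cmod ((a (Suc m) - \<kappa>) * \<zeta> ^ Suc (Suc m)) + cmod (cnj (a m - \<kappa>) * \<zeta> ^ m)"
      by (meson norm_triangle_ineq order_trans add_right_mono)
    also have "\<dots> = \<bar>d (Suc m) - D\<bar> + cmod (a (Suc m) - \<kappa>) + cmod (a m - \<kappa>)"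
      unfolding norm_mult norm_power \<zeta> complex_mod_cnj norm_of_real by simp
    also have "\<dots> \<le> E * q ^ Suc m + E * q ^ Suc m + E * q ^ m"
      by (intro add_mono diag offdiag)
    also have "\<dots> = E' * q ^ Suc m"
      using q by (simp add: E'_def field_simps)
    finally show ?thesis .
  qed
  have pointwise: "(cmod (r N n))\<^sup>2 \<le> E'\<^sup>2 * (q\<^sup>2) ^ n
      + ((if n = 0 then K\<^sup>2 else 0) + (if n = N - 1 then K\<^sup>2 else 0) + (if n = N then K\<^sup>2 else 0))" for N n
  proof -
    have nn: "0 \<le> E'\<^sup>2 * (q\<^sup>2) ^ n"
      by simp
    have K2: "(cmod (r N n))\<^sup>2 \<le> K\<^sup>2"
      by (intro power_mono crude) auto
    \<comment> \<open>Site 0 lacks a left neighbour, row N - 1 misses the cut-off wave on its right,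
      and row N still sees it on its left.\<close>
    consider "n = 0 \<or> n = N - 1 \<or> n = N" | m where "n = Suc m" "Suc n < N" | "n > N" "n \<noteq> 0"
      by (metis Suc_lessI diff_Suc_1 linorder_less_linear not0_implies_Suc)
    thus ?thesis
    proof cases
      case 1
      hence "K\<^sup>2 \<le> (if n = 0 then K\<^sup>2 else 0) + (if n = N - 1 then K\<^sup>2 else 0) + (if n = N then K\<^sup>2 else 0)"
        by auto
      thus ?thesis
        using nn K2 by linarith
    next
      case 2
      have "(cmod (r N n))\<^sup>2 \<le> (E' * q ^ n)\<^sup>2"
        unfolding 2(1) by (intro power_mono interior) (use 2 in auto)
      also have "\<dots> = E'\<^sup>2 * (q\<^sup>2) ^ n"
        by (simp add: power_mult_distrib power_mult[symmetric] mult.commute)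
      finally show ?thesis
        by (rule order_trans) simp
    next
      case 3
      hence "r N n = 0"
        by (auto simp: r_def jacobi_def u_def split: nat.splits)
      thus ?thesis
        using nn by simp
    qed
  qed
  define M where "M = E'\<^sup>2 / (1 - q\<^sup>2) + 3 * K\<^sup>2"
  have q2: "q\<^sup>2 < 1"
    using q by (simp add: power_less_one_iff)
  have M: "0 \<le> M"
    using q2 by (simp add: M_def)
  have "(\<Sum>n<m. (cmod (r N n))\<^sup>2) \<le> (sqrt M)\<^sup>2" for N m
  proof -
    have "(\<Sum>n<m. (cmod (r N n))\<^sup>2) \<le> (\<Sum>n<m. E'\<^sup>2 * (q\<^sup>2) ^ n
      + ((if n = 0 then K\<^sup>2 else 0) + (if n = N - 1 then K\<^sup>2 else 0) + (if n = N then K\<^sup>2 else 0)))"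
      by (intro sum_mono pointwise)
    also have "\<dots> = E'\<^sup>2 * (\<Sum>n<m. (q\<^sup>2) ^ n)
      + ((\<Sum>n<m. if n = 0 then K\<^sup>2 else 0) + (\<Sum>n<m. if n = N - 1 then K\<^sup>2 else 0) + (\<Sum>n<m. if n = N then K\<^sup>2 else 0))"
      by (simp only: sum.distrib sum_distrib_left)
    also have "\<dots> \<le> E'\<^sup>2 * (1 / (1 - q\<^sup>2)) + (K\<^sup>2 + K\<^sup>2 + K\<^sup>2)"
    proof (intro add_mono mult_left_mono)
      show "(\<Sum>n<m. (q\<^sup>2) ^ n) \<le> 1 / (1 - q\<^sup>2)"
        using sum_le_suminf[of "\<lambda>n. (q\<^sup>2) ^ n" "{..<m}"] q2 by (simp add: suminf_geometric summable_geometric)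
    qed (auto simp: sum.delta)
    finally show ?thesis
      using M by (simp add: M_def)
  qed
  from ell2_boundI(2)[OF this] M show "\<exists>K. \<forall>N. ell2_norm (\<lambda>n. jacobi d a (u N) n - z * u N n) \<le> K"
    unfolding r_def[symmetric] by (intro exI[of _ "sqrt M"]) auto
qed

end

section \<open>Cyclicity of the first basis vector\<close>

lemma jacobi_power_delta:
  assumes "\<And>n. a n \<noteq> 0"
  defines "\<delta> \<equiv> \<lambda>n. if n = 0 then 1 else 0"
  shows "(jacobi d a ^^ k) \<delta> k \<noteq> 0 \<and> (\<forall>n>k. (jacobi d a ^^ k) \<delta> n = 0)"
proof (induction k)
  case (Suc k)
  show ?case
    using Suc assms(1) by (auto simp: jacobi_def split: nat.splits)
qed (simp add: \<delta>_def)

text \<open>Each application of J extends the support by exactly one site, so the vectors J^k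
  \<delta> form a triangular system with nonzero diagonal. Subtracting a multiple of the last one
  clears the last coordinate, and induction does the rest.\<close>

lemma jacobi_cyclic:
  assumes "\<And>n. a n \<noteq> 0"
  defines "\<delta> \<equiv> \<lambda>n. if n = 0 then 1 else 0"
  assumes "\<And>n. N \<le> n \<Longrightarrow> g n = 0"
  shows "\<exists>c. \<forall>n. g n = (\<Sum>k<N. c k * (jacobi d a ^^ k) \<delta> n)"
  using assms(3)
proof (induction N arbitrary: g)
  case (Suc N)
  let ?v = "(jacobi d a ^^ N) \<delta>"
  have v: "?v N \<noteq> 0" "\<forall>n>N. ?v n = 0"
    using jacobi_power_delta[of a N d] assms(1) by (auto simp: \<delta>_def)
  have "g n - g N / ?v N * ?v n = 0" if "N \<le> n" for n
    using Suc.prems[of n] v that by (cases "n = N") auto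
  then obtain c where c: "\<And>n. g n - g N / ?v N * ?v n = (\<Sum>k<N. c k * (jacobi d a ^^ k) \<delta> n)"
    using Suc.IH[of "\<lambda>n. g n - g N / ?v N * ?v n"] by blast
  have "g n = (\<Sum>k<Suc N. (c(N := g N / ?v N)) k * (jacobi d a ^^ k) \<delta> n)" for n
    using c[of n] by (simp add: algebra_simps)
  thus ?case
    by blast
qed simp

lemma ell2_tail_small:
  assumes g: "g \<in> ell2" and "0 < \<epsilon>"
  shows "\<exists>N. ell2_norm (\<lambda>n. if n < N then 0 else g n) < \<epsilon>"
proof -
  have "(\<lambda>N. \<Sum>n<N. (cmod (g n))\<^sup>2) \<longlonglongrightarrow> (ell2_norm g)\<^sup>2"
    using ell2_norm_sums[OF g] by (simp add: sums_def)
  from LIMSEQ_D[OF this, of "\<epsilon>\<^sup>2"] \<open>0 < \<epsilon>\<close> obtain N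
    where N: "\<bar>(\<Sum>n<N. (cmod (g n))\<^sup>2) - (ell2_norm g)\<^sup>2\<bar> < \<epsilon>\<^sup>2"
    by auto
  have "(\<lambda>n. (cmod (g n))\<^sup>2 - (if n \<in> {..<N} then (cmod (g n))\<^sup>2 else 0)) sums
      ((ell2_norm g)\<^sup>2 - (\<Sum>n<N. (cmod (g n))\<^sup>2))"
    by (intro sums_diff ell2_norm_sums g sums_If_finite_set) auto
  also have "(\<lambda>n. (cmod (g n))\<^sup>2 - (if n \<in> {..<N} then (cmod (g n))\<^sup>2 else 0))
      = (\<lambda>n. (cmod (if n < N then 0 else g n))\<^sup>2)"
    by auto
  finally have "ell2_norm (\<lambda>n. if n < N then 0 else g n)
      = sqrt ((ell2_norm g)\<^sup>2 - (\<Sum>n<N. (cmod (g n))\<^sup>2))"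
    by (simp add: ell2_norm_def sums_iff)
  also have "\<dots> < \<epsilon>"
    using N \<open>0 < \<epsilon>\<close> by (intro real_less_lsqrt) auto
  finally show ?thesis
    by blast
qed

text \<open>The form of a Hermitian matrix is real, so on unit vectors it stays in [m, M]. A point z
  outside is strictly separated from this segment by a line, and \<zeta> rotates the normal of that
  line to the positive real direction.\<close>

lemma (in bounded_jacobi) coercive_off_numerical_range:
  assumes lower: "\<And>u. u \<in> ell2 \<Longrightarrow> m * (ell2_norm u)\<^sup>2 \<le> Re (\<Sum>n. jacobi d a u n * cnj (u n))"
    and upper: "\<And>u. u \<in> ell2 \<Longrightarrow> Re (\<Sum>n. jacobi d a u n * cnj (u n)) \<le> M * (ell2_norm u)\<^sup>2"
    and z: "z \<notin> of_real ` {m..M}"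
  obtains c \<zeta> where "0 < c" "cmod \<zeta> = 1"
    "\<And>u. u \<in> ell2 \<Longrightarrow> c * (ell2_norm u)\<^sup>2
      \<le> Re (\<zeta> * ((\<Sum>n. jacobi d a u n * cnj (u n)) - z * of_real ((ell2_norm u)\<^sup>2)))"
proof -
  let ?F = "\<lambda>u. \<Sum>n. jacobi d a u n * cnj (u n)"
  have real: "Im (?F u) = 0" if u: "u \<in> ell2" for u
  proof -
    have "(\<lambda>n. cnj (jacobi d a u n * cnj (u n))) sums cnj (?F u)"
      unfolding sums_cnj using jacobi_form_sums[OF u u] by (simp add: sums_iff)
    hence "cnj (?F u) = ?F u"
      using jacobi_symmetric[OF u u] by (simp add: sums_iff mult.commute)
    thus ?thesis
      by (simp add: complex_eq_iff)
  qed
  consider "Im z \<noteq> 0" | "Im z = 0" "Re z < m" | "Im z = 0" "M < Re z"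
  proof (cases "Im z = 0")
    case True
    hence "z = of_real (Re z)"
      by (simp add: complex_eq_iff)
    with z that True show ?thesis
      by (metis atLeastAtMost_iff image_eqI not_le)
  qed (use that in blast)
  thus ?thesis
  proof cases
    case 1
    show ?thesis
    proof (rule that)
      \<comment> \<open>For real F and s = sgn (Im z), the real part of i s (F - z n) is n |Im
        z|.\<close>
      show "0 < \<bar>Im z\<bar>" "cmod (\<i> * of_real (sgn (Im z))) = 1"
        using 1 by (auto simp: norm_mult sgn_if)
      show "\<bar>Im z\<bar> * (ell2_norm u)\<^sup>2
          \<le> Re (\<i> * of_real (sgn (Im z)) * (?F u - z * of_real ((ell2_norm u)\<^sup>2)))" if "u \<in> ell2" for u
        using real[OF that] by (simp add: sgn_if)
    qed
  next
    case 2
    show ?thesis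
    proof (rule that)
      show "0 < m - Re z" "cmod 1 = 1"
        using 2 by auto
      show "(m - Re z) * (ell2_norm u)\<^sup>2 \<le> Re (1 * (?F u - z * of_real ((ell2_norm u)\<^sup>2)))"
        if "u \<in> ell2" for u
        using lower[OF that] 2 by (simp add: algebra_simps)
    qed
  next
    case 3
    show ?thesis
    proof (rule that)
      show "0 < Re z - M" "cmod (-1) = 1"
        using 3 by auto
      show "(Re z - M) * (ell2_norm u)\<^sup>2 \<le> Re (-1 * (?F u - z * of_real ((ell2_norm u)\<^sup>2)))"
        if "u \<in> ell2" for u
        using upper[OF that] 3 by (simp add: algebra_simps)
    qed
  qed
qed

subsection \<open>A second order recurrence and its product solution\<close>

lemma three_term_recurrence_exists:
  fixes P Q :: "nat \<Rightarrow> 'a::comm_ring_1"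
  shows "\<exists>f. f 0 = 1 \<and> (\<forall>n. f (Suc n) = P n * f n - (case n of 0 \<Rightarrow> 0 | Suc m \<Rightarrow> Q m * f m))"
proof -
  \<comment> \<open>Carrying two consecutive terms turns the second order recurrence into primitive
    recursion.\<close>
  define h where "h = rec_nat (1, P 0) (\<lambda>n (u, v). (v, P (Suc n) * v - Q n * u))"
  have h: "h 0 = (1, P 0)" "h (Suc n) = (snd (h n), P (Suc n) * snd (h n) - Q n * fst (h n))" for n
    by (simp_all add: h_def split: prod.splits)
  have "fst (h (Suc n)) = P n * fst (h n) - (case n of 0 \<Rightarrow> 0 | Suc m \<Rightarrow> Q m * fst (h m))" for n
    by (cases n) (simp_all add: h)
  thus ?thesis
    by (intro exI[of _ "\<lambda>n. fst (h n)"]) (simp add: h)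
qed

text \<open>For |a| < 1 no factor vanishes, so the infinite product is the nonzero limit of its
  partial products. Near the origin this applies to all four products in the eigenfunction.\<close>

lemma qpoch_inf_limit:
  assumes q: "0 < q" "q < 1" and a: "cmod a < 1"
  shows "(\<lambda>n. \<Prod>k<n. 1 - a * of_real q ^ k) \<longlonglongrightarrow> qpoch_inf a q" "qpoch_inf a q \<noteq> 0"
proof -
  have lt: "cmod (a * of_real q ^ k) < 1" for k
  proof -
    have "cmod a * q ^ k \<le> cmod a * 1"
      using q by (intro mult_left_mono power_le_one) auto
    thus ?thesis
      using a q by (simp add: norm_mult norm_power)
  qed
  have "convergent_prod (\<lambda>k. 1 + - (a * of_real q ^ k))"
  proof (rule summable_imp_convergent_prod_complex)
    show "summable (\<lambda>k. cmod (- (a * of_real q ^ k)))"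
      using q by (simp add: norm_mult norm_power summable_mult summable_geometric)
    show "- (a * of_real q ^ k) \<noteq> -1" for k
      using lt[of k] by auto
  qed
  hence conv: "convergent_prod (\<lambda>k. 1 - a * of_real q ^ k)"
    by simp
  show "(\<lambda>n. \<Prod>k<n. 1 - a * of_real q ^ k) \<longlonglongrightarrow> qpoch_inf a q"
    using convergent_prod_LIMSEQ[OF conv] by (simp add: qpoch_inf_def LIMSEQ_lessThan_iff_atMost)
  show "qpoch_inf a q \<noteq> 0"
    unfolding qpoch_inf_def
  proof (rule prodinf_nonzero[OF conv])
    show "1 - a * of_real q ^ k \<noteq> 0" for k
      using lt[of k] by (metis norm_one order_less_irrefl right_minus_eq)
  qed
qed

text \<open>
  The recurrence for the coefficients is the \<open>q\<close>-difference equation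
  \<open>(1 - x\<^sub>1 t) (1 - x\<^sub>2 t) F t = (1 - y\<^sub>1 t) (1 - y\<^sub>2 t) F (q t)\<close>, whose iteration gives the product.
\<close>

lemma q_difference_has_fps_expansion:
  fixes F :: "complex fps" and x1 x2 y1 y2 :: complex
  assumes q: "0 < q" "q < 1"
    and rec: "\<And>n. (1 - of_real q ^ Suc n) * fps_nth F (Suc n)
      = (x1 + x2 - (y1 + y2) * of_real q ^ n) * fps_nth F n
        - (case n of 0 \<Rightarrow> 0 | Suc m \<Rightarrow> (x1 * x2 - y1 * y2 * of_real q ^ m) * fps_nth F m)"
  shows "(\<lambda>t. fps_nth F 0 * (qpoch_inf (y1 * t) q * qpoch_inf (y2 * t) q
      / (qpoch_inf (x1 * t) q * qpoch_inf (x2 * t) q))) has_fps_expansion F"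
proof -
  \<comment> \<open>W dominates the sum of the moduli of the recurrence coefficients. Since 1 -
    q^(n+1) is at least 1 - q, one step multiplies the bound by at most K.\<close>
  define W where "W = 1 + cmod x1 + cmod x2 + cmod y1 + cmod y2 + cmod (x1 * x2) + cmod (y1 * y2)"
  define K where "K = W / (1 - q)"
  have W1: "1 \<le> W"
    by (simp add: W_def)
  have K1: "1 \<le> K"
    using W1 q by (simp add: K_def field_simps)
  have q_pow: "q ^ n \<le> 1" for n
    using q by (simp add: power_le_one)
  have growth: "cmod (fps_nth F n) \<le> K ^ n * cmod (fps_nth F 0)
      \<and> cmod (fps_nth F (Suc n)) \<le> K ^ Suc n * cmod (fps_nth F 0)" for n
  proof -
    have step: "cmod (fps_nth F (Suc n)) \<le> K * B"
      if B: "cmod (fps_nth F n) \<le> B" "\<And>m. n = Suc m \<Longrightarrow> cmod (fps_nth F m) \<le> B" for n B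
    proof -
      have B0: "0 \<le> B"
        using order_trans[OF norm_ge_zero B(1)] .
      have c1: "cmod (x1 + x2 - (y1 + y2) * of_real q ^ n) \<le> cmod x1 + cmod x2 + cmod y1 + cmod y2"
      proof -
        have "cmod ((y1 + y2) * of_real q ^ n) \<le> cmod (y1 + y2) * 1"
          unfolding norm_mult using q q_pow by (intro mult_left_mono) (auto simp: norm_power)
        thus ?thesis
          using norm_triangle_ineq4[of "x1 + x2" "(y1 + y2) * of_real q ^ n"]
            norm_triangle_ineq[of x1 x2] norm_triangle_ineq[of y1 y2] by linarith
      qed
      have c2: "cmod (x1 * x2 - y1 * y2 * of_real q ^ m) \<le> cmod (x1 * x2) + cmod (y1 * y2)" for m
      proof -
        have "cmod (y1 * y2 * of_real q ^ m) \<le> cmod (y1 * y2) * 1"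
          unfolding norm_mult[of "y1 * y2"] using q q_pow by (intro mult_left_mono) (auto simp: norm_power)
        thus ?thesis
          using norm_triangle_ineq4[of "x1 * x2" "y1 * y2 * of_real q ^ m"] by linarith
      qed
      have "(1 - q ^ Suc n) * cmod (fps_nth F (Suc n)) = cmod ((1 - of_real q ^ Suc n) * fps_nth F (Suc n))"
      proof -
        have "1 - of_real q ^ Suc n = complex_of_real (1 - q ^ Suc n)"
          by simp
        thus ?thesis
          unfolding norm_mult using q_pow[of "Suc n"] by (simp del: of_real_diff of_real_power power_Suc)
      qed
      also have "\<dots> \<le> cmod ((x1 + x2 - (y1 + y2) * of_real q ^ n) * fps_nth F n)
          + cmod (case n of 0 \<Rightarrow> 0 | Suc m \<Rightarrow> (x1 * x2 - y1 * y2 * of_real q ^ m) * fps_nth F m)"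
        unfolding rec by (rule norm_triangle_ineq4)
      also have "\<dots> \<le> (cmod x1 + cmod x2 + cmod y1 + cmod y2) * B + (cmod (x1 * x2) + cmod (y1 * y2)) * B"
      proof (rule add_mono)
        show "cmod (case n of 0 \<Rightarrow> 0 | Suc m \<Rightarrow> (x1 * x2 - y1 * y2 * of_real q ^ m) * fps_nth F m)
            \<le> (cmod (x1 * x2) + cmod (y1 * y2)) * B"
        proof (cases n)
          case (Suc m)
          thus ?thesis
            using mult_mono[OF c2[of m] B(2)[OF Suc]] by (simp add: norm_mult[of "_ - _"])
        qed (use B0 in simp)
      qed (unfold norm_mult, intro mult_mono c1 B, auto)
      also have "\<dots> \<le> W * B"
        using B0 by (simp add: W_def algebra_simps)
      finally have "(1 - q ^ Suc n) * cmod (fps_nth F (Suc n)) \<le> W * B" .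
      moreover have "(1 - q) * cmod (fps_nth F (Suc n)) \<le> (1 - q ^ Suc n) * cmod (fps_nth F (Suc n))"
        using power_decreasing[of 1 "Suc n" q] q by (intro mult_right_mono) auto
      ultimately have "(1 - q) * cmod (fps_nth F (Suc n)) \<le> W * B"
        by linarith
      thus ?thesis
        using q by (simp add: K_def pos_le_divide_eq mult.commute)
    qed
    show ?thesis
    proof (induction n)
      case 0
      show ?case
        using step[of 0 "cmod (fps_nth F 0)"] by simp
    next
      case (Suc n)
      have "cmod (fps_nth F n) \<le> K ^ Suc n * cmod (fps_nth F 0)"
        using conjunct1[OF Suc] power_increasing[of n "Suc n" K] K1
        by (meson order_trans mult_right_mono norm_ge_zero le_SucI order_refl)
      with step[of "Suc n" "K ^ Suc n * cmod (fps_nth F 0)"] conjunct2[OF Suc] show ?case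
        by (auto simp: mult.assoc)
    qed
  qed
  have summ: "summable (\<lambda>n. fps_nth F n * t ^ n)" if t: "cmod t * K < 1" for t
  proof (rule summable_comparison_test')
    show "summable (\<lambda>n. cmod (fps_nth F 0) * (cmod t * K) ^ n)"
      using t K1 by (intro summable_mult summable_geometric) auto
    show "cmod (fps_nth F n * t ^ n) \<le> cmod (fps_nth F 0) * (cmod t * K) ^ n" for n
      using mult_right_mono[OF conjunct1[OF growth[of n]], of "cmod t ^ n"]
      by (simp add: norm_mult norm_power power_mult_distrib mult_ac)
  qed
  \<comment> \<open>This makes r K = 1 / (2 W) and r W = 1 / (2 K), both below 1: the first gives
    convergence of the series, the second nonvanishing of the products.\<close>
  define r where "r = 1 / (2 * W * K)"
  have r: "0 < r" "r * K < 1" "r * W < 1"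
    using W1 K1 by (auto simp: r_def field_simps intro: le_less_trans[of _ 1])
  have radius: "ereal r \<le> fps_conv_radius F"
    using conv_radius_geI[OF summ[of "of_real r"]] r by (simp add: fps_conv_radius_def)
  have radius_pos: "0 < fps_conv_radius F"
    using r radius by (metis ereal_less(2) less_le_trans)
  have small: "cmod (x1 * t) < 1" "cmod (x2 * t) < 1" "cmod (y1 * t) < 1" "cmod (y2 * t) < 1" "cmod t * K < 1"
    if t: "cmod t < r" for t
  proof -
    have *: "cmod (w * t) < 1" if "cmod w \<le> W" for w
      using mult_mono[OF that less_imp_le[OF t]] W1 r by (simp add: norm_mult mult.commute)
    show "cmod (x1 * t) < 1" "cmod (x2 * t) < 1" "cmod (y1 * t) < 1" "cmod (y2 * t) < 1"
      by (rule *; simp add: W_def)+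
    show "cmod t * K < 1"
      using le_less_trans[OF mult_right_mono[OF less_imp_le[OF t]] r(2)] K1 by simp
  qed
  let ?f = "eval_fps F"
  \<comment> \<open>Multiplying the recurrence by t^(n+1) and summing gives f(t) - f(q t) on the
    left; each factor q^n on the right turns f(t) into f(q t).\<close>
  have q_diff: "(1 - x1 * t) * (1 - x2 * t) * ?f t = (1 - y1 * t) * (1 - y2 * t) * ?f (of_real q * t)"
    if t: "cmod t < r" for t
  proof -
    have qt: "cmod (of_real q * t) < r"
      using q t by (simp add: norm_mult) (meson le_less_trans less_imp_le mult_left_le_one_le norm_ge_zero)
    have A: "(\<lambda>n. fps_nth F n * s ^ n) sums ?f s" if "cmod s < r" for s
      using summ[OF small(5)[OF that]] by (simp add: eval_fps_def summable_sums)
    note At = A[OF t] and Aq = A[OF qt]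
    have tail: "(\<lambda>n. fps_nth F (Suc n) * s ^ Suc n) sums (?f s - fps_nth F 0)" if "cmod s < r" for s
      using A[OF that] sums_Suc_iff[of "\<lambda>n. fps_nth F n * s ^ n" "?f s - fps_nth F 0"] by simp
    have "(\<lambda>n. fps_nth F (Suc n) * t ^ Suc n - fps_nth F (Suc n) * (of_real q * t) ^ Suc n) sums
        ((?f t - fps_nth F 0) - (?f (of_real q * t) - fps_nth F 0))"
      by (intro sums_diff tail t qt)
    moreover have "(\<lambda>n. fps_nth F (Suc n) * t ^ Suc n - fps_nth F (Suc n) * (of_real q * t) ^ Suc n) sums
        ((x1 + x2) * t * ?f t - (y1 + y2) * t * ?f (of_real q * t)
          - (x1 * x2 * t\<^sup>2 * ?f t - y1 * y2 * t\<^sup>2 * ?f (of_real q * t)))"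
    proof -
      have "(\<lambda>m. case Suc m of 0 \<Rightarrow> 0 | Suc m \<Rightarrow> (x1 * x2 * t\<^sup>2 * (fps_nth F m * t ^ m)
          - y1 * y2 * t\<^sup>2 * (fps_nth F m * (of_real q * t) ^ m))) sums
          (x1 * x2 * t\<^sup>2 * ?f t - y1 * y2 * t\<^sup>2 * ?f (of_real q * t))"
        unfolding nat.case by (intro sums_diff sums_mult At Aq)
      from sums_Suc[OF this] have quad: "(\<lambda>n. case n of 0 \<Rightarrow> 0 | Suc m \<Rightarrow>
          (x1 * x2 * t\<^sup>2 * (fps_nth F m * t ^ m) - y1 * y2 * t\<^sup>2 * (fps_nth F m * (of_real q * t) ^ m))) sums
          (x1 * x2 * t\<^sup>2 * ?f t - y1 * y2 * t\<^sup>2 * ?f (of_real q * t))"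
        by simp
      have eq: "fps_nth F (Suc n) * t ^ Suc n - fps_nth F (Suc n) * (of_real q * t) ^ Suc n
          = (x1 + x2) * t * (fps_nth F n * t ^ n) - (y1 + y2) * t * (fps_nth F n * (of_real q * t) ^ n)
            - (case n of 0 \<Rightarrow> 0 | Suc m \<Rightarrow> (x1 * x2 * t\<^sup>2 * (fps_nth F m * t ^ m)
                - y1 * y2 * t\<^sup>2 * (fps_nth F m * (of_real q * t) ^ m)))" for n
      proof -
        have "fps_nth F (Suc n) * t ^ Suc n - fps_nth F (Suc n) * (of_real q * t) ^ Suc n
            = (1 - of_real q ^ Suc n) * fps_nth F (Suc n) * t ^ Suc n"
          by (simp add: power_mult_distrib algebra_simps)
        also have "\<dots> = (x1 + x2) * t * (fps_nth F n * t ^ n) - (y1 + y2) * t * (fps_nth F n * (of_real q * t) ^ n)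
            - (case n of 0 \<Rightarrow> 0 | Suc m \<Rightarrow> (x1 * x2 * t\<^sup>2 * (fps_nth F m * t ^ m)
                - y1 * y2 * t\<^sup>2 * (fps_nth F m * (of_real q * t) ^ m)))"
          unfolding rec by (cases n) (simp_all add: power_mult_distrib power2_eq_square algebra_simps)
        finally show ?thesis .
      qed
      show ?thesis
        unfolding eq by (intro sums_diff sums_mult At Aq quad)
    qed
    ultimately have "(?f t - fps_nth F 0) - (?f (of_real q * t) - fps_nth F 0)
        = (x1 + x2) * t * ?f t - (y1 + y2) * t * ?f (of_real q * t)
          - (x1 * x2 * t\<^sup>2 * ?f t - y1 * y2 * t\<^sup>2 * ?f (of_real q * t))"
      by (rule sums_unique2)
    thus ?thesis
      by (simp add: algebra_simps power2_eq_square)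
  qed
  have iterate: "(\<Prod>k<n. 1 - x1 * t * of_real q ^ k) * (\<Prod>k<n. 1 - x2 * t * of_real q ^ k) * ?f t
      = (\<Prod>k<n. 1 - y1 * t * of_real q ^ k) * (\<Prod>k<n. 1 - y2 * t * of_real q ^ k) * ?f (of_real q ^ n * t)"
    if t: "cmod t < r" for t n
  proof (induction n)
    case (Suc n)
    have "cmod (of_real q ^ n * t) \<le> 1 * cmod t"
      unfolding norm_mult using q q_pow by (intro mult_right_mono) (auto simp: norm_power)
    hence "cmod (of_real q ^ n * t) < r"
      using t by simp
    from q_diff[OF this]
    have *: "(1 - x1 * t * of_real q ^ n) * (1 - x2 * t * of_real q ^ n) * ?f (of_real q ^ n * t)
        = (1 - y1 * t * of_real q ^ n) * (1 - y2 * t * of_real q ^ n) * ?f (of_real q ^ Suc n * t)"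
      by (simp add: mult_ac)
    have "(\<Prod>k<Suc n. 1 - x1 * t * of_real q ^ k) * (\<Prod>k<Suc n. 1 - x2 * t * of_real q ^ k) * ?f t
        = (1 - x1 * t * of_real q ^ n) * (1 - x2 * t * of_real q ^ n)
          * ((\<Prod>k<n. 1 - x1 * t * of_real q ^ k) * (\<Prod>k<n. 1 - x2 * t * of_real q ^ k) * ?f t)"
      by (simp only: prod.lessThan_Suc mult_ac)
    also have "\<dots> = (\<Prod>k<n. 1 - y1 * t * of_real q ^ k) * (\<Prod>k<n. 1 - y2 * t * of_real q ^ k)
          * ((1 - x1 * t * of_real q ^ n) * (1 - x2 * t * of_real q ^ n) * ?f (of_real q ^ n * t))"
      unfolding Suc.IH by (simp only: mult_ac)
    also have "\<dots> = (\<Prod>k<Suc n. 1 - y1 * t * of_real q ^ k) * (\<Prod>k<Suc n. 1 - y2 * t * of_real q ^ k)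
          * ?f (of_real q ^ Suc n * t)"
      unfolding * by (simp only: prod.lessThan_Suc mult_ac)
    finally show ?case .
  qed simp
  have product: "fps_nth F 0 * (qpoch_inf (y1 * t) q * qpoch_inf (y2 * t) q
      / (qpoch_inf (x1 * t) q * qpoch_inf (x2 * t) q)) = ?f t" if t: "cmod t < r" for t
  proof -
    \<comment> \<open>Continuity at 0 fixes the remaining factor f(q^n t) as n grows: it tends to
      the constant coefficient.\<close>
    have "isCont ?f 0"
      using radius_pos continuous_on_eval_fps[of F]
      by (intro continuous_on_interior[of "eball 0 (fps_conv_radius F)"]) (auto simp: interior_open zero_ereal_def)
    moreover have "(\<lambda>n. of_real q ^ n * t) \<longlonglongrightarrow> 0"
      using q by (intro tendsto_mult_left_zero LIMSEQ_power_zero) auto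
    ultimately have "(\<lambda>n. ?f (of_real q ^ n * t)) \<longlonglongrightarrow> ?f 0"
      by (rule isCont_tendsto_compose)
    hence f0: "(\<lambda>n. ?f (of_real q ^ n * t)) \<longlonglongrightarrow> fps_nth F 0"
      by (simp add: eval_fps_at_0)
    note lim = qpoch_inf_limit[OF q]
    have "(\<lambda>n. (\<Prod>k<n. 1 - x1 * t * of_real q ^ k) * (\<Prod>k<n. 1 - x2 * t * of_real q ^ k) * ?f t)
        \<longlonglongrightarrow> qpoch_inf (x1 * t) q * qpoch_inf (x2 * t) q * ?f t"
      by (intro tendsto_intros lim small t)
    moreover have "(\<lambda>n. (\<Prod>k<n. 1 - x1 * t * of_real q ^ k) * (\<Prod>k<n. 1 - x2 * t * of_real q ^ k) * ?f t)
        \<longlonglongrightarrow> qpoch_inf (y1 * t) q * qpoch_inf (y2 * t) q * fps_nth F 0"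
      unfolding iterate[OF t] by (intro tendsto_intros lim small t f0)
    ultimately have "qpoch_inf (x1 * t) q * qpoch_inf (x2 * t) q * ?f t
        = qpoch_inf (y1 * t) q * qpoch_inf (y2 * t) q * fps_nth F 0"
      by (rule LIMSEQ_unique)
    thus ?thesis
      using lim(2)[OF small(1)[OF t]] lim(2)[OF small(2)[OF t]] by (simp add: field_simps)
  qed
  have "eventually (\<lambda>t. t \<in> ball 0 r) (nhds (0 :: complex))"
    using r by (intro eventually_nhds_in_open) auto
  hence "eventually (\<lambda>t. ?f t = fps_nth F 0 * (qpoch_inf (y1 * t) q * qpoch_inf (y2 * t) q
      / (qpoch_inf (x1 * t) q * qpoch_inf (x2 * t) q))) (nhds 0)"
    by eventually_elim (rule product[symmetric], simp)
  with radius_pos show ?thesis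
    by (simp add: has_fps_expansion_def)
qed

subsection \<open>The operator \<open>I\<^sub>1\<close>\<close>

locale discrete_series =
  fixes q l \<phi> :: real
  assumes q: "0 < q" "q < 1" and l: "0 < l"
begin

section \<open>Parameters and entries of the Jacobi matrix\<close>

definition B :: real where "B = 1 / (q powr (- 1 / 2) - q powr (1 / 2))"

definition \<alpha> :: real where "\<alpha> = q powr (l + 1 / 4)"

definition \<beta> :: real where "\<beta> = q powr (l - 1 / 4)"

text \<open>Twice the modulus of the off-diagonal entry of M, so that the free limit is 1.\<close>

definition A :: "nat \<Rightarrow> real" where "A n = sqrt ((1 - q ^ Suc n) * (1 - \<alpha> * \<beta> * q ^ n))"

definition diag :: "nat \<Rightarrow> real" where "diag n = B * (1 - (\<alpha> + \<beta>) * q ^ n / 2)"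

text \<open>This entry leads from site n+1 to site n and hence carries the phase of
  \<open>J_minus\<close>; its conjugate carries that of \<open>J_plus\<close>.\<close>

definition offdiag :: "nat \<Rightarrow> complex" where
  "offdiag n = - of_real (B / 2 * A n) * exp (- \<i> * of_real \<phi>)"

abbreviation coord :: "complex fps \<Rightarrow> nat \<Rightarrow> complex" where "coord \<equiv> dsr_coord q l"

lemma B_pos: "0 < B"
  using q powr_less_mono'[of q "- 1 / 2" "1 / 2"] by (simp add: B_def)

lemma two_B: "2 * q powr (1 / 2) / (1 - q) = 2 * B"
proof -
  have "q powr (1 / 2) * (q powr (- 1 / 2) - q powr (1 / 2)) = 1 - q"
    using q by (simp add: right_diff_distrib flip: powr_add)
  moreover have "q powr (- 1 / 2) - q powr (1 / 2) > 0"
    using B_pos by (simp add: B_def)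
  ultimately show ?thesis
    using q unfolding B_def by (simp add: field_simps)
qed

lemma \<alpha>_\<beta>: "\<alpha> * \<beta> = q powr (2 * l)"
  using q by (simp add: \<alpha>_def \<beta>_def flip: powr_add)

lemma \<alpha>_pos: "0 < \<alpha>" and \<beta>_pos: "0 < \<beta>" and \<alpha>_less_1: "\<alpha> < 1" and \<alpha>_\<beta>_less_1: "\<alpha> * \<beta> < 1"
  unfolding \<alpha>_\<beta> using q l powr_less_mono'[of q 0 "l + 1 / 4"] powr_less_mono'[of q 0 "2 * l"]
  by (auto simp: \<alpha>_def \<beta>_def)

lemma q_power_bounds: "0 < q ^ n" "q ^ n \<le> 1" "q ^ Suc n < 1" "\<alpha> * \<beta> * q ^ n < 1"
proof -
  show "0 < q ^ n" "q ^ n \<le> 1" "q ^ Suc n < 1"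
    using q power_Suc_less_one[OF q] by (auto simp: power_le_one)
  show "\<alpha> * \<beta> * q ^ n < 1"
    using mult_left_mono[OF \<open>q ^ n \<le> 1\<close> less_imp_le[OF mult_pos_pos[OF \<alpha>_pos \<beta>_pos]]] \<alpha>_\<beta>_less_1
    by linarith
qed

lemma A_square: "(A n)\<^sup>2 = (1 - q ^ Suc n) * (1 - \<alpha> * \<beta> * q ^ n)"
  unfolding A_def using q_power_bounds(3,4)[of n] by (intro real_sqrt_pow2) auto

lemma A_pos: "0 < A n"
  unfolding A_def using q_power_bounds(3,4)[of n] by simp

lemma A_le_1: "A n \<le> 1"
proof -
  have "(1 - q ^ Suc n) * (1 - \<alpha> * \<beta> * q ^ n) \<le> 1 * 1"
    using q_power_bounds(3,4)[of n] q_power_bounds(1)[of n] q_power_bounds(1)[of "Suc n"] \<alpha>_pos \<beta>_pos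
    by (intro mult_mono) auto
  thus ?thesis
    by (simp add: A_def)
qed

text \<open>Since A lies in (0, 1], it is at least its own square, which contains no root.\<close>

lemma A_ge: "1 - 2 * q ^ n \<le> A n"
proof -
  have "A n * A n \<le> A n * 1"
    using A_pos[of n] A_le_1[of n] by (intro mult_left_mono) auto
  moreover have "1 - 2 * q ^ n \<le> (1 - q ^ Suc n) * (1 - \<alpha> * \<beta> * q ^ n)"
  proof -
    have "q ^ Suc n \<le> q ^ n"
      using q by (intro power_decreasing) auto
    moreover have "\<alpha> * \<beta> * q ^ n \<le> 1 * q ^ n"
      using \<alpha>_\<beta>_less_1 q_power_bounds(1)[of n] by (intro mult_right_mono) auto
    moreover have "0 \<le> q ^ Suc n * (\<alpha> * \<beta> * q ^ n)"
      using \<alpha>_pos \<beta>_pos q by simp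
    ultimately show ?thesis
      by (simp only: left_diff_distrib right_diff_distrib)
  qed
  ultimately show ?thesis
    using A_square[of n] by (simp add: power2_eq_square)
qed

lemma norm_offdiag: "cmod (offdiag n) = B / 2 * A n"
  using B_pos A_pos[of n] by (simp add: offdiag_def norm_mult)

interpretation bounded_jacobi diag offdiag "B * (1 + (\<alpha> + \<beta>) / 2)"
proof
  fix n
  have "(\<alpha> + \<beta>) * q ^ n \<le> (\<alpha> + \<beta>) * 1" "0 \<le> (\<alpha> + \<beta>) * q ^ n"
    using \<alpha>_pos \<beta>_pos q q_power_bounds(2) by (auto intro!: mult_left_mono)
  hence "\<bar>1 - (\<alpha> + \<beta>) * q ^ n / 2\<bar> \<le> 1 + (\<alpha> + \<beta>) / 2"
    by (simp only: abs_le_iff) linarith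
  thus "\<bar>diag n\<bar> \<le> B * (1 + (\<alpha> + \<beta>) / 2)"
    using B_pos by (simp add: diag_def abs_mult)
  have "B / 2 * A n \<le> B * (1 + (\<alpha> + \<beta>) / 2)"
    using B_pos A_le_1[of n] A_pos[of n] \<alpha>_pos \<beta>_pos by (intro mult_mono) (auto simp: add_divide_distrib)
  thus "cmod (offdiag n) \<le> B * (1 + (\<alpha> + \<beta>) / 2)"
    by (simp add: norm_offdiag)
qed

section \<open>From q-number weights to Jacobi entries\<close>

lemma qnum_factor: "qnum q c = B * q powr (- c / 2) * (1 - q powr c)"
proof -
  have "q powr (- c / 2) * (1 - q powr c) = q powr (- c / 2) - q powr (c / 2)"
    using q by (simp add: right_diff_distrib flip: powr_add)
  moreover have "qnum q c = (q powr (- c / 2) - q powr (c / 2)) * B"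
    unfolding qnum_def B_def
    by (metis (no_types, opaque_lifting) minus_diff_eq minus_divide_divide times_divide_eq_right mult.right_neutral)
  ultimately show ?thesis
    by simp
qed

text \<open>The two factors from q^(J_0/4) contribute q^((2l+2n+1)/4), which cancels the growing
  power in the root of the q-numbers. This is why the entries are bounded. Comparing squares avoids
  manipulating the roots.\<close>

lemma J_weight:
  "q powr (1 / 4 * (l + real n)) * q powr (1 / 4 * (l + real (Suc n)))
    * sqrt (qnum q (2 * l + real n) * qnum q (real n + 1)) = B * A n"
proof -
  define w where "w = q powr (1 / 4 * (l + real n)) * q powr (1 / 4 * (l + real (Suc n)))"
  have w: "0 < w"
    using q by (simp add: w_def)
  have "w * w * (q powr (- (2 * l + real n) / 2) * q powr (- (real n + 1) / 2)) = 1"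
    using q unfolding w_def powr_add[symmetric] by (simp add: field_simps)
  moreover have "q powr (2 * l + real n) = \<alpha> * \<beta> * q ^ n" "q powr (real n + 1) = q ^ Suc n"
    using q by (simp_all add: \<alpha>_\<beta> powr_add powr_realpow)
  moreover have "w\<^sup>2 * (qnum q (2 * l + real n) * qnum q (real n + 1))
      = w * w * (q powr (- (2 * l + real n) / 2) * q powr (- (real n + 1) / 2))
        * (B\<^sup>2 * ((1 - q powr (real n + 1)) * (1 - q powr (2 * l + real n))))"
    unfolding qnum_factor power2_eq_square by (simp only: mult_ac)
  ultimately have "w\<^sup>2 * (qnum q (2 * l + real n) * qnum q (real n + 1)) = (B * A n)\<^sup>2"
    by (simp only: power_mult_distrib A_square mult_1)
  hence "sqrt (w\<^sup>2 * (qnum q (2 * l + real n) * qnum q (real n + 1))) = B * A n"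
    using B_pos A_pos[of n] by simp
  thus ?thesis
    using w unfolding w_def[symmetric] by (simp add: real_sqrt_mult)
qed

text \<open>Here the parameters arise: the summands q^(1/4) and q^(-1/4) of a, times q^(l+n), are
  \<alpha> q^n and \<beta> q^n, and b is -B.\<close>

lemma J0_weight:
  "(q powr (1 / 4) + q powr (- 1 / 4)) * (1 / (q powr (1 / 2) - q powr (- 1 / 2))) / 2 * q powr (1 * (l + real n))
    - 1 / (q powr (1 / 2) - q powr (- 1 / 2)) = diag n"
proof -
  have b: "1 / (q powr (1 / 2) - q powr (- 1 / 2)) = - B"
    unfolding B_def by (metis minus_diff_eq minus_divide_right)
  have "q powr (1 / 4) * q powr (l + real n) = \<alpha> * q ^ n" "q powr (- 1 / 4) * q powr (l + real n) = \<beta> * q ^ n"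
    unfolding \<alpha>_def \<beta>_def powr_realpow[OF q(1), symmetric] powr_add[symmetric]
    by (simp_all add: algebra_simps)
  hence "(q powr (1 / 4) + q powr (- 1 / 4)) * q powr (l + real n) = (\<alpha> + \<beta>) * q ^ n"
    by (simp only: distrib_right)
  moreover have "x * (- B) / 2 * y - (- B) = B * (1 - x * y / 2)" for x y
    by (simp add: field_simps)
  ultimately show ?thesis
    unfolding b diag_def by (simp only: mult_1)
qed

section \<open>Transport to orthonormal coordinates\<close>

lemma coord_add: "coord (g + h) = (\<lambda>n. coord g n + coord h n)"
  by (rule ext) (simp add: dsr_coord_def add_divide_distrib)

lemma coord_diff: "coord (g - h) = (\<lambda>n. coord g n - coord h n)"
  by (rule ext) (simp add: dsr_coord_def diff_divide_distrib)

lemma coord_const_mult: "coord (fps_const c * g) = (\<lambda>n. c * coord g n)"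
  by (rule ext) (simp add: dsr_coord_def)

lemma coord_sum: "coord (\<Sum>k<N. g k) n = (\<Sum>k<N. coord (g k) n)"
  by (simp add: dsr_coord_def fps_sum_nth sum_divide_distrib)

lemma coord_series: "coord (dsr_series q l u) = u"
  by (rule ext) (rule dsr_coord_series[OF q l])

lemma coord_eqI: "coord g = coord h \<Longrightarrow> g = h"
  by (metis dsr_series_coord[OF q l])

text \<open>Holding for every formal series, this serves both the Hilbert space claims and the
  formal eigenvalue equation.\<close>

lemma coord_I1: "coord (I1 q l \<phi> g) = jacobi diag offdiag (coord g)"
proof
  fix n
  let ?u = "coord g"
  let ?s = "\<lambda>n. sqrt (qnum q (2 * l + real n) * qnum q (real n + 1))"
  let ?w = "\<lambda>n. q powr (1 / 4 * (l + real n))"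
  define da where "da = (q powr (1 / 4) + q powr (- 1 / 4)) * (1 / (q powr (1 / 2) - q powr (- 1 / 2))) / 2"
  define b where "b = 1 / (q powr (1 / 2) - q powr (- 1 / 2))"
  have "coord (I1 q l \<phi> g) n = of_real da * (of_real (q powr (1 * (l + real n))) * ?u n) - of_real b * ?u n
      - 1 / 2 * (of_real (?w n) * (exp (\<i> * of_real \<phi>) *
          (case n of 0 \<Rightarrow> 0 | Suc m \<Rightarrow> of_real (?s m) * (of_real (?w m) * ?u m))
        + exp (- \<i> * of_real \<phi>) * (of_real (?s n) * (of_real (?w (Suc n)) * ?u (Suc n)))))"
    unfolding I1_def Let_def qpow_J0_def J_plus_def J_minus_def da_def b_def
    by (simp only: coord_add coord_diff coord_const_mult coord_series)
  also have "\<dots> = of_real (da * q powr (1 * (l + real n)) - b) * ?u n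
      - 1 / 2 * exp (- \<i> * of_real \<phi>) * of_real (?w n * ?w (Suc n) * ?s n) * ?u (Suc n)
      - (case n of 0 \<Rightarrow> 0 | Suc m \<Rightarrow> 1 / 2 * exp (\<i> * of_real \<phi>) * of_real (?w m * ?w (Suc m) * ?s m) * ?u m)"
    by (cases n) (simp_all add: algebra_simps)
  also have "\<dots> = jacobi diag offdiag ?u n"
    unfolding J_weight J0_weight da_def b_def jacobi_def offdiag_def
    by (cases n) (simp_all add: exp_cnj mult_ac)
  finally show "coord (I1 q l \<phi> g) n = jacobi diag offdiag ?u n" .
qed

lemma dsr_space_iff: "g \<in> dsr_space q l \<longleftrightarrow> coord g \<in> ell2"
  by (simp add: dsr_space_def ell2_def)

lemma dsr_norm_eq:
  assumes "g \<in> dsr_space q l"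
  shows "dsr_norm q l g = ell2_norm (coord g)"
proof -
  have "(\<lambda>n. complex_of_real ((cmod (coord g n))\<^sup>2)) sums of_real ((ell2_norm (coord g))\<^sup>2)"
    unfolding sums_of_real_iff using assms by (intro ell2_norm_sums) (simp add: dsr_space_iff)
  thus ?thesis
    using assms by (simp add: dsr_norm_def dsr_inner_def sums_iff dsr_space_iff flip: complex_norm_square)
qed

lemma coord_I1_power: "coord ((I1 q l \<phi> ^^ k) g) = (jacobi diag offdiag ^^ k) (coord g)"
  by (induction k) (simp_all add: coord_I1)

section \<open>Boundedness, symmetry and simplicity\<close>

lemma I1_bounded: "dsr_bounded_op q l (I1 q l \<phi>)"
  unfolding dsr_bounded_op_def
proof (intro conjI ballI allI exI)
  show space: "I1 q l \<phi> g \<in> dsr_space q l" if "g \<in> dsr_space q l" for g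
    using that jacobi_bounded(1) by (simp add: dsr_space_iff coord_I1)
  show "I1 q l \<phi> (g + h) = I1 q l \<phi> g + I1 q l \<phi> h" for g h
    by (rule coord_eqI) (simp add: coord_I1 coord_add jacobi_add)
  show "I1 q l \<phi> (fps_const c * g) = fps_const c * I1 q l \<phi> g" for c g
    by (rule coord_eqI) (simp add: coord_I1 coord_const_mult jacobi_cmult)
  show "dsr_norm q l (I1 q l \<phi> g) \<le> 3 * (B * (1 + (\<alpha> + \<beta>) / 2)) * dsr_norm q l g"
    if "g \<in> dsr_space q l" for g
    using that jacobi_bounded(2)[of "coord g"] space[OF that]
    by (simp add: dsr_norm_eq coord_I1 dsr_space_iff)
qed

lemma I1_selfadjoint: "dsr_selfadjoint q l (I1 q l \<phi>)"
  unfolding dsr_selfadjoint_def dsr_inner_def coord_I1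
  by (auto simp: dsr_space_iff intro!: jacobi_symmetric)

lemma I1_simple: "dsr_simple_spectrum q l (I1 q l \<phi>)"
  unfolding dsr_simple_spectrum_def
proof (intro bexI ballI allI impI)
  let ?\<delta> = "\<lambda>n. if n = 0 then 1 else 0 :: complex"
  let ?v = "dsr_series q l ?\<delta>"
  have "summable (\<lambda>n. (cmod (?\<delta> n))\<^sup>2)"
    by (rule summable_finite[of "{0}"]) auto
  thus "?v \<in> dsr_space q l"
    by (simp add: dsr_space_iff coord_series ell2_def)
  fix g and \<epsilon> :: real
  assume g: "g \<in> dsr_space q l" and "0 < \<epsilon>"
  then obtain N where N: "ell2_norm (\<lambda>n. if n < N then 0 else coord g n) < \<epsilon>"
    using ell2_tail_small unfolding dsr_space_iff by blast
  have "offdiag n \<noteq> 0" for n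
    using norm_offdiag[of n] B_pos A_pos[of n] by auto
  \<comment> \<open>The truncation of g lies exactly in the span, so the approximation error is the
    tail alone.\<close>
  from jacobi_cyclic[of offdiag N "\<lambda>n. if n < N then coord g n else 0" diag, OF this]
  obtain c where c: "\<And>n. (if n < N then coord g n else 0)
      = (\<Sum>k<N. c k * (jacobi diag offdiag ^^ k) ?\<delta> n)"
    by auto
  let ?h = "g - (\<Sum>k<N. fps_const (c k) * (I1 q l \<phi> ^^ k) ?v)"
  have eq: "coord ?h = (\<lambda>n. if n < N then 0 else coord g n)"
    by (rule ext) (simp add: coord_diff coord_sum coord_const_mult coord_I1_power coord_series flip: c)
  moreover have "coord ?h \<in> ell2"
    unfolding eq by (rule ell2_mono(1)[of "coord g" 1]) (use g in \<open>auto simp: dsr_space_iff\<close>)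
  ultimately have "dsr_norm q l ?h < \<epsilon>"
    using N by (simp add: dsr_norm_eq dsr_space_iff)
  thus "\<exists>N c. dsr_norm q l (g - (\<Sum>k<N. fps_const (c k) * (I1 q l \<phi> ^^ k) ?v)) < \<epsilon>"
    by blast
qed

section \<open>Bounds on the numerical range\<close>

lemma form_upper:
  assumes "u \<in> ell2"
  shows "Re (\<Sum>n. jacobi diag offdiag u n * cnj (u n)) \<le> 2 * B * (ell2_norm u)\<^sup>2"
\<comment> \<open>Constant weights suffice at this end: off-diagonal moduli are at most B/2, and the
  diagonal is at most B because \<alpha> + \<beta> > 0.\<close>
proof (rule jacobi_form_bound[OF assms, where X = "\<lambda>_. B / 2" and Y = "\<lambda>_. B / 2"])
  show "(cmod (offdiag n))\<^sup>2 \<le> B / 2 * (B / 2)" for n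
    using A_le_1[of n] A_pos[of n] B_pos mult_mono[of "B / 2 * A n" "B / 2" "B / 2 * A n" "B / 2"]
    by (simp add: norm_offdiag power2_eq_square)
  show "B / 2 + B / 2 + diag n \<le> 2 * B" for n
    using B_pos \<alpha>_pos \<beta>_pos q mult_nonneg_nonneg[of B "(\<alpha> + \<beta>) * q ^ n"]
    by (simp add: diag_def right_diff_distrib)
qed (use B_pos in auto)

text \<open>
  The weights \<open>X\<close> and \<open>Y\<close> below come from the positive solution of the recurrence at \<open>\<nu> = 1\<close>
  in the case \<open>\<beta> = 1\<close>; for \<open>\<beta> < 1\<close> they remain admissible because \<open>(1 - \<alpha>) (1 - \<beta>) \<ge> 0\<close>.
\<close>

lemma form_lower:
  assumes "u \<in> ell2" and "1 / 4 \<le> l"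
  shows "0 * (ell2_norm u)\<^sup>2 \<le> Re (\<Sum>n. jacobi diag offdiag u n * cnj (u n))"
proof -
  \<comment> \<open>A lower bound for the form of J is an upper bound for that of -J, so the
    weighted estimate applies with \<open>K = 0\<close>.\<close>
  interpret neg: bounded_jacobi "\<lambda>n. - diag n" "\<lambda>n. - offdiag n" "B * (1 + (\<alpha> + \<beta>) / 2)"
    by unfold_locales (use diag_bound offdiag_bound in auto)
  have \<beta>_le: "\<beta> \<le> 1"
    using q assms(2) powr_mono'[of 0 "l - 1 / 4" q] by (simp add: \<beta>_def)
  have neg: "jacobi (\<lambda>n. - diag n) (\<lambda>n. - offdiag n) u n = - jacobi diag offdiag u n" for n
    by (cases n) (simp_all add: jacobi_def)
  \<comment> \<open>\<open>X n + Y n\<close> equals \<open>diag n\<close>, so the diagonal is used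
    up exactly, and \<open>Y (Suc n)\<close> supplies the factor 1 - q^(n+1) of the squared entry.
    It remains to compare \<alpha> \<beta> with \<alpha> + \<beta> - 1.\<close>
  define X where "X n = B / 2 * (1 - (\<alpha> + \<beta> - 1) * q ^ n)" for n
  define Y where "Y n = B / 2 * (1 - q ^ n)" for n
  have "Re (\<Sum>n. jacobi (\<lambda>n. - diag n) (\<lambda>n. - offdiag n) u n * cnj (u n)) \<le> 0 * (ell2_norm u)\<^sup>2"
  proof (rule neg.jacobi_form_bound[OF assms(1), where X = X and Y = Y])
    fix n
    have "(\<alpha> + \<beta> - 1) * q ^ n \<le> 1 * q ^ n"
      using \<alpha>_less_1 \<beta>_le q by (intro mult_right_mono) auto
    hence "0 \<le> 1 - (\<alpha> + \<beta> - 1) * q ^ n"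
      using q_power_bounds(2)[of n] by simp
    thus "0 \<le> X n"
      using B_pos by (simp add: X_def)
    show "0 \<le> Y n"
      using B_pos q_power_bounds(2)[of n] by (simp add: Y_def)
    have "0 \<le> (1 - \<alpha>) * (1 - \<beta>)"
      using \<alpha>_less_1 \<beta>_le by simp
    hence "(\<alpha> + \<beta> - 1) * q ^ n \<le> \<alpha> * \<beta> * q ^ n"
      using q by (intro mult_right_mono) (auto simp: algebra_simps)
    hence "(1 - q ^ Suc n) * (1 - \<alpha> * \<beta> * q ^ n) \<le> (1 - q ^ Suc n) * (1 - (\<alpha> + \<beta> - 1) * q ^ n)"
      using q_power_bounds(3)[of n] by (intro mult_left_mono) auto
    hence "(B / 2)\<^sup>2 * ((1 - q ^ Suc n) * (1 - \<alpha> * \<beta> * q ^ n))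
        \<le> (B / 2)\<^sup>2 * ((1 - q ^ Suc n) * (1 - (\<alpha> + \<beta> - 1) * q ^ n))"
      by (rule mult_left_mono) simp
    thus "(cmod (- offdiag n))\<^sup>2 \<le> X n * Y (Suc n)"
      unfolding norm_minus_cancel norm_offdiag power_mult_distrib A_square X_def Y_def
      by (simp add: power2_eq_square mult_ac)
    show "X n + Y n + - diag n \<le> 0"
      by (simp add: X_def Y_def diag_def field_simps)
  qed
  moreover have "summable (\<lambda>n. jacobi diag offdiag u n * cnj (u n))"
    using jacobi_form_sums[OF assms(1,1)] by (rule sums_summable)
  ultimately show ?thesis
    unfolding neg by (simp add: suminf_minus)
qed

section \<open>Location of the spectrum\<close>

lemma spectrum_subset:
  assumes "1 / 4 \<le> l"
  shows "dsr_spectrum q l (I1 q l \<phi>) \<subseteq> of_real ` {0..2 * B}"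
proof
  fix z
  assume "z \<in> dsr_spectrum q l (I1 q l \<phi>)"
  hence not_res: "z \<notin> dsr_resolvent_set q l (I1 q l \<phi>)"
    by (simp add: dsr_spectrum_def)
  show "z \<in> of_real ` {0..2 * B}"
  proof (rule ccontr)
    assume "z \<notin> of_real ` {0..2 * B}"
    from coercive_off_numerical_range[OF form_lower[OF _ assms] form_upper this]
    obtain c \<zeta> where c: "0 < c" "cmod \<zeta> = 1"
      "\<And>u. u \<in> ell2 \<Longrightarrow> c * (ell2_norm u)\<^sup>2
        \<le> Re (\<zeta> * ((\<Sum>n. jacobi diag offdiag u n * cnj (u n)) - z * of_real ((ell2_norm u)\<^sup>2)))"
      by blast
    from coercive_surj[OF c] obtain K where "\<forall>g\<in>ell2. \<exists>u\<in>ell2. ell2_norm u \<le> K * ell2_norm g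
        \<and> (\<forall>n. jacobi diag offdiag u n - z * u n = g n)"
      by blast
    then obtain U where U: "\<And>g. g \<in> ell2 \<Longrightarrow> U g \<in> ell2"
        "\<And>g. g \<in> ell2 \<Longrightarrow> ell2_norm (U g) \<le> K * ell2_norm g"
        "\<And>g n. g \<in> ell2 \<Longrightarrow> jacobi diag offdiag (U g) n - z * U g n = g n"
      by metis
    \<comment> \<open>U was selected by choice; uniqueness of solutions is what makes it additive,
      homogeneous and a left inverse.\<close>
    have U_eq: "U g = u" if "g \<in> ell2" "u \<in> ell2" "\<And>n. jacobi diag offdiag u n - z * u n = g n" for g u
      by (rule coercive_inj[OF c(1,3)]) (use that U in auto)
    define R where "R g = dsr_series q l (U (coord g))" for g
    have R: "coord (R g) = U (coord g)" for g
      by (simp add: R_def coord_series)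
    have R_space: "R g \<in> dsr_space q l" if "g \<in> dsr_space q l" for g
      using that U(1) by (simp add: dsr_space_iff R)
    have "dsr_bounded_op q l R"
      unfolding dsr_bounded_op_def
    proof (intro conjI ballI allI exI)
      show "R g \<in> dsr_space q l" if "g \<in> dsr_space q l" for g
        using that by (rule R_space)
      show "R (g + h) = R g + R h" if "g \<in> dsr_space q l" "h \<in> dsr_space q l" for g h
      proof (rule coord_eqI)
        have "U (coord (g + h)) = (\<lambda>n. U (coord g) n + U (coord h) n)"
        proof (rule U_eq)
          show "jacobi diag offdiag (\<lambda>n. U (coord g) n + U (coord h) n) n
              - z * (U (coord g) n + U (coord h) n) = coord (g + h) n" for n
            using U(3)[of "coord g" n] U(3)[of "coord h" n] that
            unfolding jacobi_add coord_add dsr_space_iff by (simp add: algebra_simps)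
        qed (use that U in \<open>auto simp: coord_add dsr_space_iff intro!: ell2_add\<close>)
        thus "coord (R (g + h)) = coord (R g + R h)"
          unfolding R coord_add[of "R g"] .
      qed
      show "R (fps_const w * g) = fps_const w * R g" if "g \<in> dsr_space q l" for w g
      proof (rule coord_eqI)
        have "U (coord (fps_const w * g)) = (\<lambda>n. w * U (coord g) n)"
        proof (rule U_eq)
          show "jacobi diag offdiag (\<lambda>n. w * U (coord g) n) n - z * (w * U (coord g) n)
              = coord (fps_const w * g) n" for n
            using arg_cong[OF U(3)[OF that[unfolded dsr_space_iff], of n], of "(*) w"]
            unfolding jacobi_cmult coord_const_mult by (simp add: right_diff_distrib mult_ac)
        qed (use that U in \<open>auto simp: coord_const_mult dsr_space_iff intro!: ell2_cmult\<close>)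
        thus "coord (R (fps_const w * g)) = coord (fps_const w * R g)"
          unfolding R coord_const_mult[of w "R g"] .
      qed
      show "dsr_norm q l (R g) \<le> K * dsr_norm q l g" if "g \<in> dsr_space q l" for g
        using that U(2)[of "coord g"] R_space[OF that] by (simp add: dsr_norm_eq R dsr_space_iff)
    qed
    moreover have "I1 q l \<phi> (R g) - fps_const z * R g = g \<and> R (I1 q l \<phi> g - fps_const z * g) = g"
      if "g \<in> dsr_space q l" for g
    proof
      show "I1 q l \<phi> (R g) - fps_const z * R g = g"
        by (rule coord_eqI, rule ext)
           (use that U(3) in \<open>simp add: coord_diff coord_const_mult coord_I1 R dsr_space_iff\<close>)
      show "R (I1 q l \<phi> g - fps_const z * g) = g"
        by (rule coord_eqI)
           (use that resolvent_bounded(1) in \<open>auto simp: R coord_diff coord_const_mult coord_I1 dsr_space_iff intro!: U_eq\<close>)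
    qed
    ultimately have "z \<in> dsr_resolvent_set q l (I1 q l \<phi>)"
      unfolding dsr_resolvent_set_def by blast
    with not_res show False ..
  qed
qed

text \<open>Weyl's criterion: a bounded inverse with constant K, applied to the residuals of the
  truncated waves, would give sqrt N \<le> |K| M for every N.\<close>

lemma interval_subset_spectrum:
  "of_real ` {0..2 * B} \<subseteq> dsr_spectrum q l (I1 q l \<phi>)"
proof clarify
  fix s
  assume s: "s \<in> {0..2 * B}"
  \<comment> \<open>This solves s = B (1 - cos \<theta>). The wave number is \<theta> + \<phi>
    because the shift by \<phi> undoes the phase of the limiting off-diagonal entry.\<close>
  define \<theta> where "\<theta> = arccos (1 - s / B)"
  define \<kappa> where "\<kappa> = - of_real (B / 2) * exp (- \<i> * of_real \<phi>)"
  define \<zeta> where "\<zeta> = exp (\<i> * of_real (\<theta> + \<phi>))"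
  define E where "E = B * (1 + (\<alpha> + \<beta>) / 2)"
  define u where "u N n = (if n < N then \<zeta> ^ n else 0)" for N n
  have \<theta>: "cos \<theta> = 1 - s / B"
    unfolding \<theta>_def using s B_pos by (intro cos_arccos) (auto simp: field_simps)
  have \<zeta>: "cmod \<zeta> = 1"
    unfolding \<zeta>_def by (rule norm_exp_i_times)
  have z: "of_real s = of_real B + \<kappa> * \<zeta> + cnj \<kappa> * cnj \<zeta>"
  proof -
    have "\<kappa> * \<zeta> = - of_real (B / 2) * exp (\<i> * of_real \<theta>)"
      by (simp add: \<kappa>_def \<zeta>_def distrib_left flip: exp_add)
    moreover have "\<kappa> * \<zeta> + cnj \<kappa> * cnj \<zeta> = of_real (2 * Re (\<kappa> * \<zeta>))"
      by (metis complex_add_cnj complex_cnj_mult)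
    ultimately have "\<kappa> * \<zeta> + cnj \<kappa> * cnj \<zeta> = of_real (- B * cos \<theta>)"
      by (simp add: Re_exp)
    thus ?thesis
      using B_pos by (simp add: \<theta> add.assoc right_diff_distrib)
  qed
  have dn: "\<bar>diag n - B\<bar> \<le> E * q ^ n" for n
  proof -
    have "diag n - B = - (B * ((\<alpha> + \<beta>) / 2) * q ^ n)"
      by (simp add: diag_def algebra_simps)
    hence "\<bar>diag n - B\<bar> = B * ((\<alpha> + \<beta>) / 2) * q ^ n"
      using B_pos \<alpha>_pos \<beta>_pos q by (simp add: abs_mult)
    also have "\<dots> \<le> E * q ^ n"
      unfolding E_def using B_pos q by (intro mult_right_mono mult_left_mono) auto
    finally show ?thesis .
  qed
  have an: "cmod (offdiag n - \<kappa>) \<le> E * q ^ n" for n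
  proof -
    have "offdiag n - \<kappa> = of_real (B / 2 * (1 - A n)) * exp (- \<i> * of_real \<phi>)"
      by (simp add: offdiag_def \<kappa>_def algebra_simps)
    hence "cmod (offdiag n - \<kappa>) = \<bar>B / 2 * (1 - A n)\<bar>"
      by (simp only: norm_mult norm_of_real) simp
    also have "\<dots> = B / 2 * (1 - A n)"
      using B_pos A_le_1[of n] by simp
    also have "\<dots> \<le> B / 2 * (2 * q ^ n)"
      using B_pos A_ge[of n] by (intro mult_left_mono) auto
    also have "\<dots> \<le> E * q ^ n"
      using B_pos \<alpha>_pos \<beta>_pos q mult_right_mono[of B E "q ^ n"] by (simp add: E_def)
    finally show ?thesis .
  qed
  note weyl = approximate_eigenvectors[OF q \<zeta> dn an z, folded u_def]
  show "of_real s \<in> dsr_spectrum q l (I1 q l \<phi>)"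
  proof (rule ccontr)
    assume "of_real s \<notin> dsr_spectrum q l (I1 q l \<phi>)"
    then obtain R where R: "dsr_bounded_op q l R"
      "\<And>g. g \<in> dsr_space q l \<Longrightarrow> R (I1 q l \<phi> g - fps_const (of_real s) * g) = g"
      unfolding dsr_spectrum_def dsr_resolvent_set_def by auto
    obtain K where K: "\<And>g. g \<in> dsr_space q l \<Longrightarrow> dsr_norm q l (R g) \<le> K * dsr_norm q l g"
      using R(1) unfolding dsr_bounded_op_def by blast
    obtain M where M: "\<And>N. ell2_norm (\<lambda>n. jacobi diag offdiag (u N) n - of_real s * u N n) \<le> M"
      using weyl(3) by blast
    have "sqrt (real N) \<le> \<bar>K\<bar> * M" for N
    proof -
      define g where "g = dsr_series q l (u N)"
      define h where "h = I1 q l \<phi> g - fps_const (of_real s) * g"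
      have g: "coord g = u N"
        by (simp add: g_def coord_series)
      have g_space: "g \<in> dsr_space q l"
        using weyl(1) by (simp add: dsr_space_iff g)
      have h: "coord h = (\<lambda>n. jacobi diag offdiag (u N) n - of_real s * u N n)"
        by (simp add: h_def coord_diff coord_const_mult coord_I1 g)
      have h_space: "h \<in> dsr_space q l"
        unfolding dsr_space_iff h by (rule resolvent_bounded[OF weyl(1)])
      have "sqrt (real N) = dsr_norm q l (R h)"
        using R(2)[OF g_space] weyl(2)[of N] dsr_norm_eq[OF g_space] by (simp add: h_def g)
      also have "\<dots> \<le> K * dsr_norm q l h"
        by (rule K[OF h_space])
      also have "\<dots> \<le> \<bar>K\<bar> * M"
        using M[of N] dsr_norm_eq[OF h_space] ell2_norm_nonneg[of "coord h"] h_space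
        by (intro mult_mono) (auto simp: h dsr_space_iff)
      finally show ?thesis .
    qed
    hence bound: "real N \<le> (\<bar>K\<bar> * M)\<^sup>2" for N
      using power_mono[of "sqrt (real N)" "\<bar>K\<bar> * M" 2] by simp
    obtain N where "(\<bar>K\<bar> * M)\<^sup>2 < real N"
      using reals_Archimedean2 by blast
    with bound[of N] show False
      by simp
  qed
qed

section \<open>Formal eigenfunctions\<close>

lemma dsr_const_Suc:
  "dsr_const q l (Suc n) = dsr_const q l n * q powr ((1 - 2 * l) / 4)
     * sqrt ((1 - \<alpha> * \<beta> * q ^ n) / (1 - q ^ Suc n))"
proof -
  have "q powr ((1 - 2 * l) * real (Suc n) / 4) = q powr ((1 - 2 * l) * real n / 4) * q powr ((1 - 2 * l) / 4)"
    unfolding powr_add[symmetric] by (rule arg_cong[of _ _ "(powr) q"]) (simp add: field_simps)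
  moreover have "qpoch (q powr (2 * l)) q (Suc n) / qpoch q q (Suc n)
      = qpoch (q powr (2 * l)) q n / qpoch q q n * ((1 - \<alpha> * \<beta> * q ^ n) / (1 - q ^ Suc n))"
    by (simp add: qpoch_def \<alpha>_\<beta>)
  ultimately show ?thesis
    unfolding dsr_const_def by (simp only: real_sqrt_mult) simp
qed

text \<open>Both A n and the ratio of consecutive basis constants contain the same two roots. They
  combine to a full factor in either direction, so passing from coordinates to power series
  coefficients removes all roots.\<close>

lemma
  defines "c \<equiv> dsr_const q l" and "\<tau> \<equiv> q powr ((1 - 2 * l) / 4)"
  shows offdiag_ratio_up: "\<tau> * A n * c n = (1 - q ^ Suc n) * c (Suc n)"
    and offdiag_ratio_down: "A n * c (Suc n) = \<tau> * (1 - \<alpha> * \<beta> * q ^ n) * c n"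
proof -
  let ?x = "1 - q ^ Suc n" and ?y = "1 - \<alpha> * \<beta> * q ^ n"
  have pos: "0 < ?x" "0 < ?y"
    using q_power_bounds(3,4)[of n] by auto
  have c: "c (Suc n) = c n * \<tau> * (sqrt ?y / sqrt ?x)"
    unfolding c_def \<tau>_def dsr_const_Suc by (simp only: real_sqrt_divide)
  have A: "A n = sqrt ?x * sqrt ?y"
    by (simp only: A_def real_sqrt_mult)
  have xx: "?x = sqrt ?x * sqrt ?x" and yy: "?y = sqrt ?y * sqrt ?y"
    using pos by simp_all
  have nz: "sqrt ?x \<noteq> 0"
    using pos by simp
  have "sqrt ?x * sqrt ?x * (c n * \<tau> * (sqrt ?y / sqrt ?x)) = \<tau> * (sqrt ?x * sqrt ?y) * c n"
    using nz by (simp only: times_divide_eq_right mult_ac) (simp add: mult_ac del: real_sqrt_mult_self)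
  thus "\<tau> * A n * c n = ?x * c (Suc n)"
    unfolding c A using xx by metis
  have "sqrt ?x * sqrt ?y * (c n * \<tau> * (sqrt ?y / sqrt ?x)) = \<tau> * (sqrt ?y * sqrt ?y) * c n"
    using nz by (simp only: times_divide_eq_right mult_ac) (simp add: mult_ac del: real_sqrt_mult_self)
  thus "A n * c (Suc n) = \<tau> * ?y * c n"
    unfolding c A using yy by metis
qed

text \<open>Row n of the eigenvalue equation is multiplied by 2 \<kappa> c_n, with \<kappa> = \<tau>
  exp (i \<phi>). This factor is nonzero, so the equivalence survives, and it clears the roots. The
  coefficients match because x1 + x2 = 2 \<nu> \<kappa>, x1 x2 = \<kappa>^2, y1 = \<kappa> \<beta>
  and y2 = \<kappa> \<alpha>.\<close>

lemma eigen_recurrence: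
  fixes \<theta> :: complex and F :: "complex fps"
  defines "x1 \<equiv> of_real (q powr ((1 - 2 * l) / 4)) * exp (\<i> * (\<theta> + of_real \<phi>))"
    and "x2 \<equiv> of_real (q powr ((1 - 2 * l) / 4)) * exp (- \<i> * (\<theta> - of_real \<phi>))"
    and "y1 \<equiv> of_real (q powr (l / 2)) * exp (\<i> * of_real \<phi>)"
    and "y2 \<equiv> of_real (q powr ((l + 1) / 2)) * exp (\<i> * of_real \<phi>)"
  shows "I1 q l \<phi> F = fps_const (I1_eigenval q (cos \<theta>)) * F \<longleftrightarrow>
    (\<forall>n. (1 - of_real q ^ Suc n) * fps_nth F (Suc n)
      = (x1 + x2 - (y1 + y2) * of_real q ^ n) * fps_nth F n
        - (case n of 0 \<Rightarrow> 0 | Suc m \<Rightarrow> (x1 * x2 - y1 * y2 * of_real q ^ m) * fps_nth F m))"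
proof -
  define \<tau> where "\<tau> = q powr ((1 - 2 * l) / 4)"
  define e where "e = exp (\<i> * of_real \<phi>)"
  define \<kappa> where "\<kappa> = of_real \<tau> * e"
  define c where "c = dsr_const q l"
  define \<nu> where "\<nu> = cos \<theta>"
  have e: "e \<noteq> 0" "exp (- \<i> * of_real \<phi>) = inverse e"
    by (simp_all add: e_def exp_minus)
  have \<tau>: "0 < \<tau>"
    using q by (simp add: \<tau>_def)
  have c: "c n > 0" for n
    unfolding c_def by (rule dsr_const_pos[OF q l])
  have x: "x1 = \<kappa> * exp (\<i> * \<theta>)" "x2 = \<kappa> * exp (- (\<i> * \<theta>))"
    unfolding x1_def x2_def \<kappa>_def \<tau>_def e_def
    by (simp_all add: mult.assoc algebra_simps flip: exp_add)
  have x_sum: "x1 + x2 = 2 * \<nu> * \<kappa>"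
    unfolding x \<nu>_def cos_exp_eq by (simp add: algebra_simps)
  have x_prod: "x1 * x2 = \<kappa>\<^sup>2"
    unfolding x by (simp add: power2_eq_square mult_ac exp_minus)
  have "q powr (l / 2) = \<tau> * \<beta>" "q powr ((l + 1) / 2) = \<tau> * \<alpha>"
    unfolding \<tau>_def \<alpha>_def \<beta>_def powr_add[symmetric]
    by (rule arg_cong[of _ _ "(powr) q"], simp add: field_simps)+
  hence y: "y1 = \<kappa> * of_real \<beta>" "y2 = \<kappa> * of_real \<alpha>"
    by (simp_all add: y1_def y2_def \<kappa>_def e_def)
  have mu: "I1_eigenval q (cos \<theta>) = of_real B * (1 - \<nu>)"
    by (simp add: I1_eigenval_def B_def \<nu>_def)
  have up: "of_real \<tau> * of_real (A n) * of_real (c n) = (1 - of_real q ^ Suc n) * complex_of_real (c (Suc n))" for n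
    using arg_cong[OF offdiag_ratio_up[of n, folded c_def \<tau>_def], of complex_of_real] by simp
  have down: "of_real (A n) * complex_of_real (c (Suc n))
      = of_real \<tau> * (1 - of_real \<alpha> * of_real \<beta> * of_real q ^ n) * of_real (c n)" for n
    using arg_cong[OF offdiag_ratio_down[of n, folded c_def \<tau>_def], of complex_of_real] by simp
  define rhs where "rhs n = (x1 + x2 - (y1 + y2) * of_real q ^ n) * fps_nth F n
        - (case n of 0 \<Rightarrow> 0 | Suc m \<Rightarrow> (x1 * x2 - y1 * y2 * of_real q ^ m) * fps_nth F m)" for n
  have next_term: "of_real (B / 2 * A n) * inverse e * coord F (Suc n) * (2 * \<kappa> * of_real (c n))
      = of_real B * ((1 - of_real q ^ Suc n) * fps_nth F (Suc n))" for n
  proof -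
    have "of_real (B / 2 * A n) * inverse e * coord F (Suc n) * (2 * \<kappa> * of_real (c n))
        = of_real B * (of_real \<tau> * of_real (A n) * of_real (c n)) * coord F (Suc n)"
      using e by (simp add: \<kappa>_def)
    also have "\<dots> = of_real B * ((1 - of_real q ^ Suc n) * (of_real (c (Suc n)) * coord F (Suc n)))"
      unfolding up by (simp only: mult_ac)
    also have "of_real (c (Suc n)) * coord F (Suc n) = fps_nth F (Suc n)"
      using c[of "Suc n"] by (simp add: dsr_coord_def c_def)
    finally show ?thesis .
  qed
  have prev_term: "of_real (B / 2 * A m) * e * coord F m * (2 * \<kappa> * of_real (c (Suc m)))
      = of_real B * ((x1 * x2 - y1 * y2 * of_real q ^ m) * fps_nth F m)" for m
  proof -
    have "of_real (B / 2 * A m) * e * coord F m * (2 * \<kappa> * of_real (c (Suc m)))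
        = of_real B * (of_real (A m) * of_real (c (Suc m))) * e * \<kappa> * coord F m"
      by simp
    also have "\<dots> = of_real B * ((\<kappa>\<^sup>2 * (1 - of_real \<alpha> * of_real \<beta> * of_real q ^ m)) * (of_real (c m) * coord F m))"
      unfolding down by (simp add: \<kappa>_def power2_eq_square)
    also have "of_real (c m) * coord F m = fps_nth F m"
      using c[of m] by (simp add: dsr_coord_def c_def)
    also have "\<kappa>\<^sup>2 * (1 - of_real \<alpha> * of_real \<beta> * of_real q ^ m) = x1 * x2 - y1 * y2 * of_real q ^ m"
      unfolding x_prod y by (simp add: power2_eq_square algebra_simps)
    finally show ?thesis .
  qed
  have diag_term: "(of_real (diag n) - of_real B * (1 - \<nu>)) * coord F n * (2 * \<kappa> * of_real (c n))
      = of_real B * ((x1 + x2 - (y1 + y2) * of_real q ^ n) * fps_nth F n)" for n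
  proof -
    have "(of_real (diag n) - of_real B * (1 - \<nu>)) * coord F n * (2 * \<kappa> * of_real (c n))
        = of_real B * ((2 * \<nu> * \<kappa> - (\<kappa> * of_real \<beta> + \<kappa> * of_real \<alpha>) * of_real q ^ n) * (of_real (c n) * coord F n))"
      by (simp add: diag_def field_simps)
    also have "of_real (c n) * coord F n = fps_nth F n"
      using c[of n] by (simp add: dsr_coord_def c_def)
    finally show ?thesis
      unfolding x_sum y .
  qed
  have key: "(jacobi diag offdiag (coord F) n - of_real B * (1 - \<nu>) * coord F n) * (2 * \<kappa> * of_real (c n))
      = of_real B * (rhs n - (1 - of_real q ^ Suc n) * fps_nth F (Suc n))" for n
  proof -
    have "jacobi diag offdiag (coord F) n - of_real B * (1 - \<nu>) * coord F n
        = (of_real (diag n) - of_real B * (1 - \<nu>)) * coord F n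
          - of_real (B / 2 * A n) * inverse e * coord F (Suc n)
          - (case n of 0 \<Rightarrow> 0 | Suc m \<Rightarrow> of_real (B / 2 * A m) * e * coord F m)"
      unfolding jacobi_def offdiag_def e(2)
      by (cases n) (simp_all add: e_def exp_cnj exp_minus algebra_simps)
    moreover have "(case n of 0 \<Rightarrow> 0 | Suc m \<Rightarrow> of_real (B / 2 * A m) * e * coord F m) * (2 * \<kappa> * of_real (c n))
        = of_real B * (case n of 0 \<Rightarrow> 0 | Suc m \<Rightarrow> (x1 * x2 - y1 * y2 * of_real q ^ m) * fps_nth F m)"
      by (cases n) (simp_all only: prev_term nat.case mult_zero_left mult_zero_right)
    ultimately have "(jacobi diag offdiag (coord F) n - of_real B * (1 - \<nu>) * coord F n) * (2 * \<kappa> * of_real (c n))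
        = of_real B * ((x1 + x2 - (y1 + y2) * of_real q ^ n) * fps_nth F n)
          - of_real B * ((1 - of_real q ^ Suc n) * fps_nth F (Suc n))
          - of_real B * (case n of 0 \<Rightarrow> 0 | Suc m \<Rightarrow> (x1 * x2 - y1 * y2 * of_real q ^ m) * fps_nth F m)"
      by (simp only: left_diff_distrib[of _ _ "2 * \<kappa> * of_real (c n)"] diag_term next_term)
    moreover have "w * x - w * y - w * s = w * (x - s - y)" for w x y s :: complex
      by (simp add: algebra_simps)
    ultimately show ?thesis
      by (simp only: rhs_def)
  qed
  have "I1 q l \<phi> F = fps_const (I1_eigenval q (cos \<theta>)) * F \<longleftrightarrow>
      coord (I1 q l \<phi> F) = coord (fps_const (I1_eigenval q (cos \<theta>)) * F)"
    using coord_eqI by metis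
  also have "\<dots> \<longleftrightarrow> (\<forall>n. (jacobi diag offdiag (coord F) n - of_real B * (1 - \<nu>) * coord F n) * (2 * \<kappa> * of_real (c n)) = 0)"
    using c e(1) \<tau> by (auto simp: fun_eq_iff coord_I1 coord_const_mult mu \<kappa>_def less_imp_neq[OF c, symmetric])
  also have "\<dots> \<longleftrightarrow> (\<forall>n. (1 - of_real q ^ Suc n) * fps_nth F (Suc n) = rhs n)"
    unfolding key using B_pos by (auto simp del: power_Suc)
  finally show ?thesis
    unfolding rhs_def .
qed

text \<open>The constant coefficient determines a solution completely, so eigenspaces are lines; the
  same fact serves existence and the converse.\<close>

lemma eigenfunction_has_fps_expansion:
  assumes "I1 q l \<phi> F = fps_const (I1_eigenval q (cos \<theta>)) * F"
  shows "(\<lambda>x. fps_nth F 0 * I1_eigenfun q l \<phi> \<theta> x) has_fps_expansion F"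
  unfolding I1_eigenfun_def
  using q_difference_has_fps_expansion[OF q assms[unfolded eigen_recurrence, rule_format]] .

lemma eigenfunction_exists:
  obtains F where "fps_nth F 0 = 1" "I1 q l \<phi> F = fps_const (I1_eigenval q (cos \<theta>)) * F"
proof -
  define x1 where "x1 = of_real (q powr ((1 - 2 * l) / 4)) * exp (\<i> * (\<theta> + of_real \<phi>))"
  define x2 where "x2 = of_real (q powr ((1 - 2 * l) / 4)) * exp (- \<i> * (\<theta> - of_real \<phi>))"
  define y1 where "y1 = of_real (q powr (l / 2)) * exp (\<i> * of_real \<phi>)"
  define y2 where "y2 = of_real (q powr ((l + 1) / 2)) * exp (\<i> * of_real \<phi>)"
  define w where "w n = 1 - complex_of_real q ^ Suc n" for n
  have w: "w n \<noteq> 0" for n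
  proof -
    have "w n = of_real (1 - q ^ Suc n)"
      by (simp add: w_def)
    thus ?thesis
      using q_power_bounds(3)[of n] by (simp del: power_Suc of_real_diff of_real_power)
  qed
  \<comment> \<open>At n = Suc m the divisor is \<open>w n\<close>, hence the shifted
    \<open>w (Suc m)\<close> in the second coefficient.\<close>
  obtain f where f: "f 0 = 1" "\<And>n. f (Suc n) = (x1 + x2 - (y1 + y2) * of_real q ^ n) / w n * f n
      - (case n of 0 \<Rightarrow> 0 | Suc m \<Rightarrow> (x1 * x2 - y1 * y2 * of_real q ^ m) / w (Suc m) * f m)"
    using three_term_recurrence_exists[of "\<lambda>n. (x1 + x2 - (y1 + y2) * of_real q ^ n) / w n"
      "\<lambda>m. (x1 * x2 - y1 * y2 * of_real q ^ m) / w (Suc m)"] by blast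
  have "w n * f (Suc n) = (x1 + x2 - (y1 + y2) * of_real q ^ n) * f n
      - (case n of 0 \<Rightarrow> 0 | Suc m \<Rightarrow> (x1 * x2 - y1 * y2 * of_real q ^ m) * f m)" for n
    unfolding f(2) using w by (cases n) (simp_all add: right_diff_distrib)
  hence "I1 q l \<phi> (Abs_fps f) = fps_const (I1_eigenval q (cos \<theta>)) * Abs_fps f"
    unfolding eigen_recurrence by (simp only: fps_nth_Abs_fps w_def x1_def x2_def y1_def y2_def) simp
  with f(1) show ?thesis
    by (intro that[of "Abs_fps f"]) auto
qed

text \<open>The complex cosine is onto, so complex \<theta> reaches every possible eigenvalue of the
  formal problem.\<close>

lemma eigenval_surj: "\<exists>\<theta>. \<mu> = I1_eigenval q (cos \<theta>)"
proof
  show "\<mu> = I1_eigenval q (cos (Arccos (1 - \<mu> / of_real B)))"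
    using B_pos by (simp add: I1_eigenval_def B_def)
qed

end

theorem theorem2:
  fixes q l \<phi> :: real
  assumes "0 < q" and "q < 1" and "0 < l" and "0 \<le> \<phi>" and "\<phi> < 2 * pi"
  shows "dsr_bounded_op q l (I1 q l \<phi>)
    \<and> dsr_selfadjoint q l (I1 q l \<phi>)
    \<and> (\<forall>\<theta>::complex. \<exists>g. I1_eigenfun q l \<phi> \<theta> has_fps_expansion g
          \<and> gen_eigenfunction (I1 q l \<phi>) (I1_eigenval q (cos \<theta>)) g)
    \<and> (\<forall>\<mu> g. gen_eigenfunction (I1 q l \<phi>) \<mu> g \<longrightarrow>
          (\<exists>\<theta> c. \<mu> = I1_eigenval q (cos \<theta>)
             \<and> (\<lambda>x. c * I1_eigenfun q l \<phi> \<theta> x) has_fps_expansion g))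
    \<and> dsr_simple_spectrum q l (I1 q l \<phi>)
    \<and> complex_of_real ` {0 .. 2 * q powr (1 / 2) / (1 - q)} \<subseteq> dsr_spectrum q l (I1 q l \<phi>)
    \<and> (1 / 4 \<le> l \<longrightarrow>
          dsr_spectrum q l (I1 q l \<phi>) = complex_of_real ` {0 .. 2 * q powr (1 / 2) / (1 - q)})"
proof -
  interpret discrete_series q l \<phi>
    using assms by unfold_locales
  have "\<exists>g. I1_eigenfun q l \<phi> \<theta> has_fps_expansion g
      \<and> gen_eigenfunction (I1 q l \<phi>) (I1_eigenval q (cos \<theta>)) g" for \<theta>
  proof -
    obtain F where F: "fps_nth F 0 = 1" "I1 q l \<phi> F = fps_const (I1_eigenval q (cos \<theta>)) * F"
      using eigenfunction_exists .
    have "F \<noteq> 0"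
      using F(1) by auto
    with F eigenfunction_has_fps_expansion[OF F(2)] show ?thesis
      by (auto simp: gen_eigenfunction_def)
  qed
  moreover have "\<exists>\<theta> c. \<mu> = I1_eigenval q (cos \<theta>) \<and> (\<lambda>x. c * I1_eigenfun q l \<phi> \<theta> x) has_fps_expansion g"
    if "gen_eigenfunction (I1 q l \<phi>) \<mu> g" for \<mu> g
    using that eigenval_surj[of \<mu>] eigenfunction_has_fps_expansion
    unfolding gen_eigenfunction_def by blast
  moreover have "1 / 4 \<le> l \<longrightarrow> dsr_spectrum q l (I1 q l \<phi>) = complex_of_real ` {0..2 * B}"
    using spectrum_subset interval_subset_spectrum by blast
  ultimately show ?thesis
    unfolding two_B using I1_bounded I1_selfadjoint I1_simple interval_subset_spectrum by blast
qed

end
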